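(* Let $\{\epsilon_k\}_{k\ge 1}$ be a nonincreasing sequence of nonnegative numbers with $\sum_{k=1}^{\infty}k\,\epsilon_k<\infty$, and let $\{\tilde z^k\}=\{(\tilde\mu^k,\tilde\lambda^k,\tilde p^k)\}$ be the sequence generated by the sGS-imABCD algorithm described in the context (with error tolerances $\epsilon_k$) applied to the discretized dual problem $$\min_{\mu,\lambda,p\in\mathbb{R}^{N_h}}\Phi_h(\mu,\lambda,p).$$ Let $z^*=(\mu^*,\lambda^*,p^* )$ be an optimal solution of this problem. Then there is a constant $c_0$ (not depending on $k$) such that $$\Phi_h(\tilde z^k)-\Phi_h(z^* )\le \frac{2\|\tilde z^0-z^*\|_{\mathcal S}^2+c_0}{(k+1)^2}\qquad\text{for all } k\ge 1,$$ where $\mathcal S:=\mathrm{Diag}(\mathcal D_1,\ \mathcal D_2+\mathcal Q_{22})$ is the block-diagonal operator on $\mathbb{R}^{N_h}\times(\mathbb{R}^{N_h}\times\mathbb{R}^{N_h})$ built from the matrices $\mathcal D_1,\mathcal D_2,\mathcal Q_{22}$ defined in the context.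
   Context: **PDE and finite element setting.** Let $n\in\{2,3\}$ and let $\Omega\subseteq\mathbb{R}^n$ be a convex, open, bounded domain with $C^{1,1}$ or polygonal/polyhedral boundary. Let $\alpha,\beta>0$ and let $a\le 0\le b$ be real numbers. Let $a_{ij}=a_{ji}\in L^\infty(\Omega)$ and $c_0(\cdot)\in L^\infty(\Omega)$ with $c_0(\cdot)\ge 0$ (this coefficient function is unrelated to the constant $c_0$ in the claim), and suppose there is $\theta>0$ with $\sum_{i,j}a_{ij}(x)\xi_i\xi_j\ge\theta\|\xi\|^2$ for a.a. $x\in\Omega$ and all $\xi\in\mathbb{R}^n$. Define the bilinear form $a(y,v)=\int_\Omega\big(\sum_{i,j=1}^n a_{ji}\,y_{x_i}v_{x_j}+c_0\,y\,v\big)\,dx$ on $H_0^1(\Omega)$. Let $\{\mathcal T_h\}_{h>0}$ be a family of triangulations, regular and quasi-uniform: with $\rho_T$ the diameter of a cell $T\in\mathcal T_h$, $\sigma_T$ the diameter of the largest ball contained in $T$, and $h=\max_T\rho_T$, there are $\kappa,\tau>0$ with $\rho_T/\sigma_T\le\kappa$ and $h/\rho_T\le\tau$ for all $T\in\mathcal T_h$ and all $h>0$. Let $\bar\Omega_h=\bigcup_{T\in\mathcal T_h}T$, with interior $\Omega_h\subset\Omega$. If $\Omega$ is a convex polyhedral domain, $\Omega_h=\Omega$; if the boundary is $C^{1,1}$, $\bar\Omega_h$ is convex, all its boundary vertices lie on $\partial\Omega$, and $|\Omega\setminus\Omega_h|\le c h^2$ for some constant $c>0$. Fix such a triangulation and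 let $\{\phi_i\}_{i=1}^{N_h}$ be the nodal basis ($\phi_i\ge 0$, $\|\phi_i\|_\infty=1$) of the space of continuous functions on $\bar\Omega$ that are affine on each $T\in\mathcal T_h$ and vanish on $\bar\Omega\setminus\Omega_h$. Define the stiffness, mass and lumped mass matrices $$K_h=\big(a(\phi_i,\phi_j)\big)_{i,j=1}^{N_h},\quad M_h=\Big(\int_{\Omega_h}\phi_i\phi_j\,dx\Big)_{i,j=1}^{N_h},\quad W_h=\mathrm{diag}\Big(\int_{\Omega_h}\phi_i\,dx\Big)_{i=1}^{N_h}.$$ Let $y_d,y_r\in\mathbb{R}^{N_h}$ be given vectors (the coefficient vectors of the $L^2$-projections onto the discrete space of a given desired state and a given source term in $L^2(\Omega)$). **Notation.** $\langle\cdot,\cdot\rangle$ and $\|\cdot\|$ are the Euclidean inner product and norm; for a symmetric positive semidefinite matrix $\mathcal M$, $\|x\|_{\mathcal M}^2=\langle x,\mathcal M x\rangle$. $\delta_{[-\beta,\beta]}$ is the indicator function of the box $\{\lambda\in\mathbb{R}^{N_h}:-\beta\le\lambda_i\le\beta\ \forall i\}$ (value $0$ on the box, $+\infty$ outside), and $\delta^*_{[a,b]}(\xi)=\sup\{\langle\xi,u\rangle: u\in\mathbb{R}^{N_h},\ a\le u_i\le b\ \forall i\}$. **Objective of the discretized dual problem.** $$\Phi_h(\mu,\lambda,p)=\tfrac12\|K_hp-M_hy_d\|_{M_h^{-1}}^2+\tfrac1{2\alpha}\|\lambda+\mu-p\|_{M_h}^2+\langle M_hy_r,p\rangle+\delta_{[-\beta,\beta]}(\lambda)+\delta^*_{[a,b]}(M_h\mu)-\tfrac12\|y_d\|_{M_h}^2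 .$$ **Matrices.** Let $c_n=4$ if $n=2$ and $c_n=5$ if $n=3$, and set $$\mathcal D_1=\tfrac1\alpha\big(c_nM_hW_h^{-1}M_h-M_h\big),\qquad \mathcal Q_{22}=\frac1\alpha\begin{pmatrix}M_h&-M_h\\-M_h&M_h+\alpha K_hM_h^{-1}K_h\end{pmatrix},$$ $$\mathcal D_2=\frac1\alpha\begin{pmatrix}M_h(M_h+\alpha K_hM_h^{-1}K_h)^{-1}M_h+W_h-M_h&0\\0&0\end{pmatrix},$$ where $\mathcal D_1$ acts on the $\mu$ block and $\mathcal Q_{22},\mathcal D_2$ act on the $(\lambda,p)$ block. **The sGS-imABCD algorithm.** Input: $(\mu^1,\lambda^1,p^1)=(\tilde\mu^0,\tilde\lambda^0,\tilde p^0)\in\mathrm{dom}(\delta^*_{[a,b]})\times[-\beta,\beta]^{N_h}\times\mathbb{R}^{N_h}$, $t_1=1$, and the sequence $\{\epsilon_k\}$. For $k=1,2,\dots$: Step 1. With error vectors $\delta_\mu^k,\hat\delta_p^k,\delta_p^k\in\mathbb{R}^{N_h}$ satisfying $\max\{\|\delta_\mu^k\|,\|\hat\delta_p^k\|,\|\delta_p^k\|\}\le\epsilon_k$, compute successively $$\tilde\mu^k=\arg\min_\mu\ \tfrac1{2\alpha}\|\mu-(p^k-\lambda^k)\|_{M_h}^2+\delta^*_{[a,b]}(M_h\mu)+\tfrac12\|\mu-\mu^k\|_{\mathcal D_1}^2-\langle\delta_\mu^k,\mu\rangle,$$ $$\hat p^k=\arg\min_p\ \tfrac12\|K_hp-M_hy_d\|_{M_h^{-1}}^2+\tfrac1{2\alpha}\|p-\lambda^k-\tilde\mu^k+\alpha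 y_r\|_{M_h}^2-\langle\hat\delta_p^k,p\rangle,$$ $$\tilde\lambda^k=\arg\min_\lambda\ \tfrac1{2\alpha}\|\lambda-(\hat p^k-\tilde\mu^k)\|_{M_h}^2+\delta_{[-\beta,\beta]}(\lambda)+\tfrac1{2\alpha}\|\lambda-\lambda^k\|_{W_h-M_h}^2,$$ $$\tilde p^k=\arg\min_p\ \tfrac12\|K_hp-M_hy_d\|_{M_h^{-1}}^2+\tfrac1{2\alpha}\|p-\tilde\lambda^k-\tilde\mu^k+\alpha y_r\|_{M_h}^2-\langle\delta_p^k,p\rangle.$$ Step 2. Set $t_{k+1}=\frac{1+\sqrt{1+4t_k^2}}2$, $\beta_k=\frac{t_k-1}{t_{k+1}}$, and $$\mu^{k+1}=\tilde\mu^k+\beta_k(\tilde\mu^k-\tilde\mu^{k-1}),\quad p^{k+1}=\tilde p^k+\beta_k(\tilde p^k-\tilde p^{k-1}),\quad \lambda^{k+1}=\tilde\lambda^k+\beta_k(\tilde\lambda^k-\tilde\lambda^{k-1}).$$ *)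

theory Defs
  imports "HOL-Analysis.Analysis"
begin

section \<open>Function spaces on a domain\<close>

definition partial :: "'n \<Rightarrow> (real^'n::finite \<Rightarrow> real) \<Rightarrow> real^'n \<Rightarrow> real" where
  "partial i f x = frechet_derivative f (at x) (axis i 1)"

primrec Ck :: "nat \<Rightarrow> (real^'n::finite \<Rightarrow> real) \<Rightarrow> bool" where
  "Ck 0 f \<longleftrightarrow> continuous_on UNIV f"
| "Ck (Suc k) f \<longleftrightarrow> (\<forall>x. f differentiable (at x)) \<and> (\<forall>i. Ck k (partial i f))"

definition test_function :: "(real^'n::finite) set \<Rightarrow> (real^'n \<Rightarrow> real) \<Rightarrow> bool" where
  "test_function \<Omega> \<psi> \<longleftrightarrow>
     (\<forall>k. Ck k \<psi>) \<and> (\<exists>C. compact C \<and> C \<subseteq> \<Omega> \<and> (\<forall>x. x \<notin> C \<longrightarrow> \<psi> x = 0))"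

definition L2 :: "(real^'n::finite) set \<Rightarrow> (real^'n \<Rightarrow> real) \<Rightarrow> bool" where
  "L2 \<Omega> f \<longleftrightarrow> f \<in> borel_measurable (lebesgue_on \<Omega>) \<and> integrable (lebesgue_on \<Omega>) (\<lambda>x. (f x)\<^sup>2)"

definition Linfty :: "(real^'n::finite) set \<Rightarrow> (real^'n \<Rightarrow> real) \<Rightarrow> bool" where
  "Linfty \<Omega> f \<longleftrightarrow>
     f \<in> borel_measurable (lebesgue_on \<Omega>) \<and> (\<exists>C. AE x in lebesgue_on \<Omega>. \<bar>f x\<bar> \<le> C)"

definition has_weak_gradient ::
  "(real^'n::finite) set \<Rightarrow> (real^'n \<Rightarrow> real) \<Rightarrow> (real^'n \<Rightarrow> real^'n) \<Rightarrow> bool" where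
  "has_weak_gradient \<Omega> f g \<longleftrightarrow>
     L2 \<Omega> f \<and> (\<forall>i. L2 \<Omega> (\<lambda>x. g x $ i)) \<and>
     (\<forall>\<psi> i. test_function \<Omega> \<psi> \<longrightarrow>
        integral\<^sup>L (lebesgue_on \<Omega>) (\<lambda>x. f x * partial i \<psi> x)
        = - integral\<^sup>L (lebesgue_on \<Omega>) (\<lambda>x. g x $ i * \<psi> x))"

text \<open>A weak gradient is unique up to null sets, so integrals do not depend on the chosen
  representative. The choice is meaningful only for functions in \<open>H\<^sup>1(\<Omega>)\<close>.\<close>

definition weak_gradient ::
  "(real^'n::finite) set \<Rightarrow> (real^'n \<Rightarrow> real) \<Rightarrow> real^'n \<Rightarrow> real^'n" where
  "weak_gradient \<Omega> f = (SOME g. has_weak_gradient \<Omega> f g)"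

definition bilinear_form ::
  "(real^'n::finite) set \<Rightarrow> (real^'n \<Rightarrow> real^'n^'n) \<Rightarrow> (real^'n \<Rightarrow> real)
    \<Rightarrow> (real^'n \<Rightarrow> real) \<Rightarrow> (real^'n \<Rightarrow> real) \<Rightarrow> real" where
  "bilinear_form \<Omega> A c y v =
     integral\<^sup>L (lebesgue_on \<Omega>) (\<lambda>x.
       (\<Sum>i\<in>UNIV. \<Sum>j\<in>UNIV. A x $ j $ i * weak_gradient \<Omega> y x $ i * weak_gradient \<Omega> v x $ j)
       + c x * y x * v x)"

definition elliptic_coefficients ::
  "(real^'n::finite) set \<Rightarrow> (real^'n \<Rightarrow> real^'n^'n) \<Rightarrow> (real^'n \<Rightarrow> real) \<Rightarrow> real \<Rightarrow> bool" where
  "elliptic_coefficients \<Omega> A c \<theta> \<longleftrightarrow>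
     (\<forall>i j. Linfty \<Omega> (\<lambda>x. A x $ i $ j)) \<and>
     (\<forall>i j. AE x in lebesgue_on \<Omega>. A x $ i $ j = A x $ j $ i) \<and>
     Linfty \<Omega> c \<and> (AE x in lebesgue_on \<Omega>. 0 \<le> c x) \<and>
     0 < \<theta> \<and>
     (AE x in lebesgue_on \<Omega>. \<forall>\<xi>::real^'n.
        (\<Sum>i\<in>UNIV. \<Sum>j\<in>UNIV. A x $ i $ j * \<xi> $ i * \<xi> $ j) \<ge> \<theta> * (norm \<xi>)\<^sup>2)"


section \<open>Domains and triangulations\<close>

text \<open>Near each boundary point the domain is, in coordinates with vertical direction \<open>\<nu>\<close>, the
  epigraph of a \<open>C\<^sup>1\<close> function with Lipschitz gradient of the horizontal part \<open>x - (x \<bullet> \<nu>) \<nu>\<close>.\<close>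

definition C11_boundary :: "(real^'n::finite) set \<Rightarrow> bool" where
  "C11_boundary \<Omega> \<longleftrightarrow>
     (\<forall>x0\<in>frontier \<Omega>. \<exists>r \<nu> \<gamma> g L.
        0 < r \<and> norm \<nu> = 1 \<and>
        (\<forall>x. (\<gamma> has_derivative (\<lambda>v. g x \<bullet> v)) (at x)) \<and>
        L-lipschitz_on UNIV g \<and>
        \<Omega> \<inter> ball x0 r = {x \<in> ball x0 r. x \<bullet> \<nu> > \<gamma> (x - (x \<bullet> \<nu>) *\<^sub>R \<nu>)})"

definition inball_diameter :: "(real^'n::finite) set \<Rightarrow> real" where
  "inball_diameter T = Sup {2 * r | r. 0 \<le> r \<and> (\<exists>z. cball z r \<subseteq> T)}"

definition mesh_size :: "(real^'n::finite) set set \<Rightarrow> real" where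
  "mesh_size \<T> = Max (diameter ` \<T>)"

definition mesh_interior :: "(real^'n::finite) set set \<Rightarrow> (real^'n) set" where
  "mesh_interior \<T> = interior (\<Union>\<T>)"

definition mesh_nodes :: "(real^'n::finite) set set \<Rightarrow> (real^'n) set" where
  "mesh_nodes \<T> = {v. \<exists>T\<in>\<T>. v extreme_point_of T}"

text \<open>The family is indexed by the set \<open>H\<close> of mesh sizes that occur: a mesh size larger than the
  diameter of the bounded domain is impossible, so \<open>H\<close> cannot be all of \<open>{0<..}\<close>.\<close>

definition mesh_family ::
  "(real^'n::finite) set \<Rightarrow> real set \<Rightarrow> (real \<Rightarrow> (real^'n) set set) \<Rightarrow> bool" where
  "mesh_family \<Omega> H \<T> \<longleftrightarrow>
     H \<subseteq> {0<..} \<and>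
     (\<forall>h\<in>H. \<T> h \<noteq> {} \<and> triangulation (\<T> h) \<and> (\<forall>T\<in>\<T> h. int CARD('n) simplex T) \<and>
        mesh_size (\<T> h) = h \<and> mesh_interior (\<T> h) \<subseteq> \<Omega>) \<and>
     (\<exists>\<kappa>>0. \<exists>\<tau>>0. \<forall>h\<in>H. \<forall>T\<in>\<T> h.
        diameter T / inball_diameter T \<le> \<kappa> \<and> h / diameter T \<le> \<tau>) \<and>
     (polytope (closure \<Omega>) \<longrightarrow> (\<forall>h\<in>H. mesh_interior (\<T> h) = \<Omega>)) \<and>
     (C11_boundary \<Omega> \<longrightarrow>
        (\<forall>h\<in>H. convex (\<Union>(\<T> h)) \<and>
           mesh_nodes (\<T> h) \<inter> frontier (\<Union>(\<T> h)) \<subseteq> frontier \<Omega>) \<and>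
        (\<exists>c>0. \<forall>h\<in>H. measure lebesgue (\<Omega> - mesh_interior (\<T> h)) \<le> c * h\<^sup>2))"

definition fe_space ::
  "(real^'n::finite) set \<Rightarrow> (real^'n) set set \<Rightarrow> (real^'n \<Rightarrow> real) set" where
  "fe_space \<Omega> \<T> = {v.
     continuous_on (closure \<Omega>) v \<and>
     (\<forall>T\<in>\<T>. \<exists>d e. \<forall>x\<in>T. v x = d \<bullet> x + e) \<and>
     (\<forall>x\<in>closure \<Omega> - mesh_interior \<T>. v x = 0)}"

definition nodal_basis ::
  "(real^'n::finite) set \<Rightarrow> (real^'n) set set \<Rightarrow> ('N::finite \<Rightarrow> real^'n \<Rightarrow> real) \<Rightarrow> bool" where
  "nodal_basis \<Omega> \<T> \<phi> \<longleftrightarrow>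
     (\<exists>node :: 'N \<Rightarrow> real^'n.
        bij_betw node UNIV (mesh_nodes \<T> \<inter> mesh_interior \<T>) \<and>
        (\<forall>i j. \<phi> i (node j) = (if i = j then 1 else 0))) \<and>
     (\<forall>i. \<phi> i \<in> fe_space \<Omega> \<T> \<and> (\<forall>x\<in>closure \<Omega>. 0 \<le> \<phi> i x) \<and>
        (SUP x\<in>closure \<Omega>. \<bar>\<phi> i x\<bar>) = 1)"

definition stiffness_matrix ::
  "(real^'n::finite) set \<Rightarrow> (real^'n \<Rightarrow> real^'n^'n) \<Rightarrow> (real^'n \<Rightarrow> real)
    \<Rightarrow> ('N::finite \<Rightarrow> real^'n \<Rightarrow> real) \<Rightarrow> real^'N^'N" where
  "stiffness_matrix \<Omega> A c \<phi> = (\<chi> i j. bilinear_form \<Omega> A c (\<phi> i) (\<phi> j))"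

definition mass_matrix ::
  "(real^'n::finite) set set \<Rightarrow> ('N::finite \<Rightarrow> real^'n \<Rightarrow> real) \<Rightarrow> real^'N^'N" where
  "mass_matrix \<T> \<phi> =
     (\<chi> i j. integral\<^sup>L (lebesgue_on (mesh_interior \<T>)) (\<lambda>x. \<phi> i x * \<phi> j x))"

definition lumped_mass_matrix ::
  "(real^'n::finite) set set \<Rightarrow> ('N::finite \<Rightarrow> real^'n \<Rightarrow> real) \<Rightarrow> real^'N^'N" where
  "lumped_mass_matrix \<T> \<phi> =
     (\<chi> i j. if i = j then integral\<^sup>L (lebesgue_on (mesh_interior \<T>)) (\<phi> i) else 0)"


section \<open>The discretized dual problem\<close>

definition sqnorm :: "real^'N::finite^'N \<Rightarrow> real^'N \<Rightarrow> real" where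
  "sqnorm A x = x \<bullet> (A *v x)"

definition sqnorm_op :: "('a::real_inner \<Rightarrow> 'a) \<Rightarrow> 'a \<Rightarrow> real" where
  "sqnorm_op S z = z \<bullet> S z"

definition box_set :: "real \<Rightarrow> real \<Rightarrow> (real^'N::finite) set" where
  "box_set a b = {u. \<forall>i. a \<le> u $ i \<and> u $ i \<le> b}"

definition indicator_fun :: "'a set \<Rightarrow> 'a \<Rightarrow> ereal" where
  "indicator_fun S x = (if x \<in> S then 0 else \<infinity>)"

definition support_fun :: "'a::real_inner set \<Rightarrow> 'a \<Rightarrow> ereal" where
  "support_fun S \<xi> = (SUP u\<in>S. ereal (\<xi> \<bullet> u))"

definition eff_dom :: "('a \<Rightarrow> ereal) \<Rightarrow> 'a set" where
  "eff_dom f = {x. f x < \<infinity>}"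

type_synonym 'N triple = "(real^'N) \<times> (real^'N) \<times> (real^'N)"

definition dual_objective ::
  "real \<Rightarrow> real \<Rightarrow> real \<Rightarrow> real \<Rightarrow> real^'N::finite^'N \<Rightarrow> real^'N^'N \<Rightarrow> real^'N \<Rightarrow> real^'N
    \<Rightarrow> 'N triple \<Rightarrow> ereal" where
  "dual_objective \<alpha> \<beta> a b K M yd yr = (\<lambda>(mu, lam, p).
     ereal (1/2 * sqnorm (matrix_inv M) (K *v p - M *v yd)
            + 1/(2*\<alpha>) * sqnorm M (lam + mu - p)
            + (M *v yr) \<bullet> p)
     + indicator_fun (box_set (-\<beta>) \<beta>) lam
     + support_fun (box_set a b) (M *v mu)
     - ereal (1/2 * sqnorm M yd))"


section \<open>The weighting operators\<close>

definition lump_const :: "nat \<Rightarrow> real" where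
  "lump_const n = (if n = 2 then 4 else 5)"

definition block_op ::
  "real^'N::finite^'N \<Rightarrow> real^'N^'N \<Rightarrow> real^'N^'N \<Rightarrow> real^'N^'N
    \<Rightarrow> (real^'N) \<times> (real^'N) \<Rightarrow> (real^'N) \<times> (real^'N)" where
  "block_op A B C D = (\<lambda>(x, y). (A *v x + B *v y, C *v x + D *v y))"

definition D1 :: "real \<Rightarrow> real \<Rightarrow> real^'N::finite^'N \<Rightarrow> real^'N^'N \<Rightarrow> real^'N^'N" where
  "D1 \<alpha> cn M W = (1/\<alpha>) *\<^sub>R (cn *\<^sub>R (M ** matrix_inv W ** M) - M)"

definition Q22 ::
  "real \<Rightarrow> real^'N::finite^'N \<Rightarrow> real^'N^'N \<Rightarrow> (real^'N) \<times> (real^'N) \<Rightarrow> (real^'N) \<times> (real^'N)" where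
  "Q22 \<alpha> K M v =
     (1/\<alpha>) *\<^sub>R block_op M (- M) (- M) (M + \<alpha> *\<^sub>R (K ** matrix_inv M ** K)) v"

definition D2 ::
  "real \<Rightarrow> real^'N::finite^'N \<Rightarrow> real^'N^'N \<Rightarrow> real^'N^'N
    \<Rightarrow> (real^'N) \<times> (real^'N) \<Rightarrow> (real^'N) \<times> (real^'N)" where
  "D2 \<alpha> K M W v =
     (1/\<alpha>) *\<^sub>R block_op
       (M ** matrix_inv (M + \<alpha> *\<^sub>R (K ** matrix_inv M ** K)) ** M + W - M) 0 0 0 v"

definition S_op ::
  "real \<Rightarrow> real \<Rightarrow> real^'N::finite^'N \<Rightarrow> real^'N^'N \<Rightarrow> real^'N^'N \<Rightarrow> 'N triple \<Rightarrow> 'N triple" where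
  "S_op \<alpha> cn K M W = (\<lambda>(mu, v). (D1 \<alpha> cn M W *v mu, D2 \<alpha> K M W v + Q22 \<alpha> K M v))"


section \<open>The algorithm\<close>

abbreviation minimizes :: "'a \<Rightarrow> ('a \<Rightarrow> ereal) \<Rightarrow> bool" where
  "minimizes x f \<equiv> is_arg_min f (\<lambda>_. True) x"

text \<open>\<open>mut\<close>, \<open>lamt\<close>, \<open>pt\<close> are the iterates with a tilde (starting at index 0), \<open>mu\<close>, \<open>lam\<close>, \<open>p\<close>
  the extrapolated points (used from index 1 on), and \<open>ph\<close> is the auxiliary iterate with a hat.\<close>

definition sGS_step ::
  "real \<Rightarrow> real \<Rightarrow> real \<Rightarrow> real \<Rightarrow> real \<Rightarrow> real^'N::finite^'N \<Rightarrow> real^'N^'N \<Rightarrow> real^'N^'N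
    \<Rightarrow> real^'N \<Rightarrow> real^'N \<Rightarrow> real
    \<Rightarrow> real^'N \<Rightarrow> real^'N \<Rightarrow> real^'N \<Rightarrow> real^'N \<Rightarrow> real^'N \<Rightarrow> real^'N \<Rightarrow> bool" where
  "sGS_step \<alpha> \<beta> a b cn K M W yd yr eps mu lam p mut lamt pt \<longleftrightarrow>
     (\<exists>dmu dph dp ph.
        Max {norm dmu, norm dph, norm dp} \<le> eps \<and>
        minimizes mut (\<lambda>m.
          ereal (1/(2*\<alpha>) * sqnorm M (m - (p - lam)))
          + support_fun (box_set a b) (M *v m)
          + ereal (1/2 * sqnorm (D1 \<alpha> cn M W) (m - mu))
          - ereal (dmu \<bullet> m)) \<and>
        minimizes ph (\<lambda>q. ereal (
          1/2 * sqnorm (matrix_inv M) (K *v q - M *v yd)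
          + 1/(2*\<alpha>) * sqnorm M (q - lam - mut + \<alpha> *\<^sub>R yr)
          - dph \<bullet> q)) \<and>
        minimizes lamt (\<lambda>l.
          ereal (1/(2*\<alpha>) * sqnorm M (l - (ph - mut)))
          + indicator_fun (box_set (-\<beta>) \<beta>) l
          + ereal (1/(2*\<alpha>) * sqnorm (W - M) (l - lam))) \<and>
        minimizes pt (\<lambda>q. ereal (
          1/2 * sqnorm (matrix_inv M) (K *v q - M *v yd)
          + 1/(2*\<alpha>) * sqnorm M (q - lamt - mut + \<alpha> *\<^sub>R yr)
          - dp \<bullet> q)))"

definition sGS_imABCD ::
  "real \<Rightarrow> real \<Rightarrow> real \<Rightarrow> real \<Rightarrow> real \<Rightarrow> real^'N::finite^'N \<Rightarrow> real^'N^'N \<Rightarrow> real^'N^'N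
    \<Rightarrow> real^'N \<Rightarrow> real^'N \<Rightarrow> (nat \<Rightarrow> real)
    \<Rightarrow> (nat \<Rightarrow> real^'N) \<Rightarrow> (nat \<Rightarrow> real^'N) \<Rightarrow> (nat \<Rightarrow> real^'N) \<Rightarrow> bool" where
  "sGS_imABCD \<alpha> \<beta> a b cn K M W yd yr eps mut lamt pt \<longleftrightarrow>
     (\<exists>mu lam p. \<exists>t :: nat \<Rightarrow> real.
        mut 0 \<in> eff_dom (support_fun (box_set a b)) \<and> lamt 0 \<in> box_set (-\<beta>) \<beta> \<and>
        mu 1 = mut 0 \<and> lam 1 = lamt 0 \<and> p 1 = pt 0 \<and> t 1 = 1 \<and>
        (\<forall>k\<ge>1.
           sGS_step \<alpha> \<beta> a b cn K M W yd yr (eps k) (mu k) (lam k) (p k) (mut k) (lamt k) (pt k) \<and>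
           t (Suc k) = (1 + sqrt (1 + 4 * (t k)\<^sup>2)) / 2 \<and>
           mu (Suc k) = mut k + ((t k - 1) / t (Suc k)) *\<^sub>R (mut k - mut (k - 1)) \<and>
           p (Suc k) = pt k + ((t k - 1) / t (Suc k)) *\<^sub>R (pt k - pt (k - 1)) \<and>
           lam (Suc k) = lamt k + ((t k - 1) / t (Suc k)) *\<^sub>R (lamt k - lamt (k - 1))))"

end

theory Submission
  imports Defs
begin

text \<open>The constant \<open>c0\<close> may depend on everything except \<open>k\<close>, so the statement is that the
  objective gap is \<open>O(1/k\<^sup>2)\<close>. This is an instance of accelerated proximal gradient descent with
  inexact steps, once a whole sweep of the block method is recognized as a single proximal step in a
  suitable seminorm.

  \<^bold>\<open>One sweep is one proximal step.\<close> The smooth part of the objective is a convex quadratic. The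
  \<open>\<mu>\<close>-update adds the proximal term of \<open>\<D>\<^sub>1\<close>. The updates of \<open>p\<close>, \<open>\<lambda>\<close>, \<open>p\<close> amount to a joint
  minimization over \<open>(\<lambda>, p)\<close> with the proximal term of \<open>\<D>\<^sub>2\<close>, because eliminating the auxiliary
  \<open>p\<close> leaves exactly the quadratic form of \<open>\<D>\<^sub>2\<close> in \<open>\<lambda>\<close>. Adding the optimality conditions of the updates
  gives the three-point inequality \<open>sGS_step_descent\<close> in the seminorm of \<open>\<S>\<close>, up to an error
  vector proportional to the tolerance. It needs both proximal terms to be positive semidefinite,
  that is \<open>M \<le> W \<le> c\<^sub>n M\<close> in the order of quadratic forms.

  \<^bold>\<open>The mass matrices.\<close> On each simplex \<open>T\<close> with vertex set \<open>C\<close> in dimension \<open>n\<close>, an affine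
  function \<open>v\<close> has \<open>\<integral> v\<^sup>2 = |T| ((\<Sum>c\<in>C. v(c)\<^sup>2) + (\<Sum>c\<in>C. v(c))\<^sup>2) / ((n+1)(n+2))\<close>, while mass lumping
  replaces this integral by \<open>|T| (\<Sum>c\<in>C. v(c)\<^sup>2) / (n+1)\<close>. Cauchy-Schwarz on the \<open>n+1\<close> vertex values gives
  \<open>M \<le> W \<le> (n+2) M\<close>, and \<open>n + 2\<close> is \<open>c\<^sub>n\<close> for \<open>n = 2, 3\<close>
  (\<open>mass_matrix_le_lumped\<close>, \<open>lumped_le_mass_matrix\<close>).

  \<^bold>\<open>Inexactness.\<close> In the energy estimate the error vector is paired with the distance of the usual
  auxiliary iterates \<open>u\<^sub>k = t\<^sub>k x\<^sub>k - (t\<^sub>k - 1) x\<^sub>k\<^sub>-\<^sub>1\<close> to the solution, and the seminorm of \<open>\<S>\<close> does not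
  control this distance, since \<open>\<D>\<^sub>1\<close> may be singular. The quadratic growth of the objective
  controls the seminorm of its Hessian, and the two seminorms together dominate the Euclidean norm
  (\<open>forms_coercive\<close>). Hence the energies \<open>A\<^sub>k\<close> satisfy
  \<open>A\<^sub>k\<^sub>+\<^sub>1 - A\<^sub>k \<le> c\<^sub>k (sqrt A\<^sub>k\<^sub>+\<^sub>1 + sqrt A\<^sub>k)\<close> with \<open>c\<^sub>k\<close> of order \<open>k \<epsilon>\<^sub>k\<close>; dividing by the sum of roots
  turns this into a telescoping inequality for \<open>sqrt A\<^sub>k\<close>, so the energies are bounded
  (\<open>inexact_accelerated_gradient_rate\<close>).\<close>

section \<open>Integrals over a simplex\<close>

lemma integrable_on_compact_continuous:
  fixes f :: "'a::euclidean_space \<Rightarrow> real"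
  assumes "compact S" "continuous_on S f"
  shows "f integrable_on S"
  using set_borel_integral_eq_integral(1)[of S f] borel_integrable_compact[OF assms]
  by (simp add: set_integrable_def)

lemma barycentric_coordinate_exists:
  fixes C :: "'a::euclidean_space set"
  assumes C: "\<not> affine_dependent C" and cC: "c \<in> C" and dC: "d \<in> C" and cd: "c \<noteq> d"
  shows "\<exists>f e. linear f \<and> (\<forall>x\<in>C. f x + e = (if x = c then 1 else 0 :: real))"
proof -
  have "independent ((\<lambda>x. - d + x) ` (C - {d}))"
    using C affine_dependent_iff_dependent2[OF dC] by blast
  from linear_independent_extend[OF this, of "\<lambda>y. if y = - d + c then 1 else 0 :: real"]
  obtain f :: "'a \<Rightarrow> real" where f: "linear f" "\<And>x. x \<in> C - {d} \<Longrightarrow> f (- d + x) = (if - d + x = - d + c then 1 else 0)"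
    by auto
  have "f x + (- f d) = (if x = c then 1 else 0)" if "x \<in> C" for x
  proof (cases "x = d")
    case True then show ?thesis using cd by simp
  next
    case False
    have "f (- d + x) = f x - f d" using linear_diff[OF f(1), of x d] by simp
    then show ?thesis using f(2)[of x] that False by auto
  qed
  with f(1) show ?thesis by blast
qed

locale full_simplex =
  fixes C :: "'a::euclidean_space set"
  assumes indep: "\<not> affine_dependent C" and card_C: "card C = DIM('a) + 1"
begin

abbreviation "T \<equiv> convex hull C"

text \<open>Barycentric coordinates as affine functions on the whole space rather than on the simplex only:
  the homotheties below then act on them by a formula valid everywhere.\<close>

definition bary :: "'a \<Rightarrow> 'a \<Rightarrow> real" where
  "bary = (SOME B. \<forall>c\<in>C. (\<exists>f e. linear f \<and> B c = (\<lambda>x. f x + e)) \<and>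
      (\<forall>x\<in>C. B c x = (if x = c then 1 else 0)))"

lemma finite_C: "finite C"
  using indep by (rule aff_independent_finite)

lemma bary_spec: "\<forall>c\<in>C. (\<exists>f e. linear f \<and> bary c = (\<lambda>x. f x + e)) \<and>
      (\<forall>x\<in>C. bary c x = (if x = c then 1 else 0))"
proof -
  have "\<exists>B. (\<exists>f e. linear f \<and> B = (\<lambda>x. f x + e)) \<and> (\<forall>x\<in>C. B x = (if x = c then 1 else 0 :: real))"
    if c: "c \<in> C" for c
  proof -
    have "card (C - {c}) \<noteq> 0" using card_C c finite_C by simp
    then obtain d where "d \<in> C" "c \<noteq> d" by (metis DiffE card.empty ex_in_conv insertI1)
    from barycentric_coordinate_exists[OF indep c this]
    obtain f e where "linear f" "\<forall>x\<in>C. f x + e = (if x = c then 1 else 0 :: real)" by blast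
    then show ?thesis by (intro exI[of _ "\<lambda>x. f x + e"]) blast
  qed
  then have "\<forall>c\<in>C. \<exists>B. (\<exists>f e. linear f \<and> B = (\<lambda>x. f x + e)) \<and>
      (\<forall>x\<in>C. B x = (if x = c then 1 else 0 :: real))" by blast
  from bchoice[OF this] show ?thesis unfolding bary_def by (rule someI_ex)
qed

lemma bary_vertex: "c \<in> C \<Longrightarrow> x \<in> C \<Longrightarrow> bary c x = (if x = c then 1 else 0)"
  using bary_spec by blast

lemma bary_sum:
  assumes "c \<in> C" "sum u I = 1" "finite I"
  shows "bary c (\<Sum>i\<in>I. u i *\<^sub>R y i) = (\<Sum>i\<in>I. u i * bary c (y i))"
proof -
  obtain f e where f: "linear f" "bary c = (\<lambda>x. f x + e)" using bary_spec assms(1) by blast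
  show ?thesis
    using assms(2) by (simp add: f(2) linear_sum[OF f(1)] linear_scale[OF f(1)] distrib_left sum.distrib
        flip: sum_distrib_right)
qed

lemma bary_combination:
  assumes "c \<in> C"
  shows "bary c (s *\<^sub>R x + (1 - s) *\<^sub>R y) = s * bary c x + (1 - s) * bary c y"
proof -
  obtain f e where f: "linear f" "bary c = (\<lambda>x. f x + e)" using bary_spec assms(1) by blast
  have "f (s *\<^sub>R x + (1 - s) *\<^sub>R y) = s * f x + (1 - s) * f y"
    by (simp only: linear_add[OF f(1)] linear_scale[OF f(1)] real_scaleR_def)
  then show ?thesis by (simp add: f(2) algebra_simps)
qed

lemma bary_continuous: "c \<in> C \<Longrightarrow> continuous_on S (bary c)"
proof -
  assume "c \<in> C"
  then obtain f e where f: "linear f" "bary c = (\<lambda>x. f x + e)" using bary_spec by blast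
  show ?thesis unfolding f(2)
    by (intro continuous_intros linear_continuous_on) (simp add: f(1) linear_conv_bounded_linear[symmetric])
qed

lemma bary_decomposition:
  shows "(\<Sum>c\<in>C. bary c x) = 1" and "(\<Sum>c\<in>C. bary c x *\<^sub>R c) = x"
proof -
  have "aff_dim C = DIM('a)" using aff_dim_affine_independent[OF indep] card_C by simp
  then have "affine hull C = UNIV" using aff_dim_eq_full by blast
  then obtain u where u: "sum u C = 1" "(\<Sum>v\<in>C. u v *\<^sub>R v) = x"
    using affine_hull_finite[OF finite_C] by blast
  have "bary c x = u c" if c: "c \<in> C" for c
  proof -
    have "bary c x = (\<Sum>v\<in>C. u v * bary c v)"
      using bary_sum[OF c u(1) finite_C, of "\<lambda>v. v"] u(2) by simp
    also have "\<dots> = (\<Sum>v\<in>C. if v = c then u v else 0)"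
      by (rule sum.cong) (use bary_vertex[OF c] in auto)
    finally show ?thesis using c finite_C by simp
  qed
  then show "(\<Sum>c\<in>C. bary c x) = 1" "(\<Sum>c\<in>C. bary c x *\<^sub>R c) = x"
    using u by (auto cong: sum.cong)
qed

lemma simplex_eq: "T = {x. \<forall>c\<in>C. 0 \<le> bary c x}"
proof (intro equalityI subsetI CollectI ballI)
  fix x c assume x: "x \<in> T" and c: "c \<in> C"
  then obtain u where u: "\<forall>v\<in>C. 0 \<le> u v" "sum u C = 1" "(\<Sum>v\<in>C. u v *\<^sub>R v) = x"
    using convex_hull_finite[OF finite_C] by auto
  have "bary c x = (\<Sum>v\<in>C. u v * bary c v)"
    using bary_sum[OF c u(2) finite_C, of "\<lambda>v. v"] u(3) by simp
  also have "0 \<le> \<dots>" by (rule sum_nonneg) (use u(1) bary_vertex[OF c] in auto)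
  finally show "0 \<le> bary c x" .
next
  fix x assume "x \<in> {x. \<forall>c\<in>C. 0 \<le> bary c x}"
  then show "x \<in> T" unfolding convex_hull_finite[OF finite_C]
    using bary_decomposition[of x] by (auto intro!: exI[of _ "\<lambda>c. bary c x"])
qed

lemma compact_simplex: "compact T"
  by (rule finite_imp_compact_convex_hull[OF finite_C])

lemma affine_on_simplex:
  assumes "x \<in> T" and v: "\<And>x. x \<in> T \<Longrightarrow> v x = k \<bullet> x + (e :: real)"
  shows "v x = (\<Sum>c\<in>C. v c * bary c x)"
proof -
  have "v x = k \<bullet> (\<Sum>c\<in>C. bary c x *\<^sub>R c) + e * (\<Sum>c\<in>C. bary c x)"
    by (simp add: v[OF assms(1)] bary_decomposition)
  also have "\<dots> = (\<Sum>c\<in>C. (k \<bullet> c + e) * bary c x)"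
    by (simp add: inner_sum_right sum_distrib_left sum.distrib algebra_simps)
  also have "\<dots> = (\<Sum>c\<in>C. v c * bary c x)"
    by (rule sum.cong) (auto simp: v hull_inc)
  finally show ?thesis .
qed

text \<open>The copy of the simplex shrunk by the factor \<open>s\<close> towards its vertex \<open>d\<close>; see \<open>homothety_region\<close>.\<close>

definition region :: "'a \<Rightarrow> real \<Rightarrow> 'a set" where
  "region d s = {x \<in> T. 1 - s \<le> bary d x}"

lemma homothety_region:
  assumes d: "d \<in> C" and s: "0 < s" "s < 1"
  shows "s *\<^sub>R x + (1 - s) *\<^sub>R d \<in> region d s \<longleftrightarrow> x \<in> T"
proof -
  have b: "bary c (s *\<^sub>R x + (1 - s) *\<^sub>R d) = s * bary c x + (if c = d then 1 - s else 0)" if "c \<in> C" for c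
    using bary_combination[OF that, of s x d] bary_vertex[OF that d] by auto
  show ?thesis
    unfolding region_def simplex_eq using b d s
    by (auto simp: zero_le_mult_iff)
qed

lemma integral_region:
  fixes f :: "'a \<Rightarrow> real"
  assumes d: "d \<in> C" and s: "0 < s" "s < 1" and f: "continuous_on UNIV f"
  shows "f integrable_on region d s"
    and "integral (region d s) f = s ^ DIM('a) * integral T (\<lambda>x. f (s *\<^sub>R x + (1 - s) *\<^sub>R d))"
proof -
  have "closed {x. 1 - s \<le> bary d x}"
    by (intro closed_Collect_le continuous_intros bary_continuous d)
  moreover have "region d s = T \<inter> {x. 1 - s \<le> bary d x}" by (auto simp: region_def)
  ultimately have comp: "compact (region d s)"
    using compact_Int_closed[OF compact_simplex] by simp
  show int: "f integrable_on region d s"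
    by (rule integrable_on_compact_continuous[OF comp continuous_on_subset[OF f]]) simp
  obtain a b where ab: "T \<subseteq> cbox a b"
    using bounded_subset_cbox_symmetric[OF compact_imp_bounded[OF compact_simplex]] by blast
  have sub: "region d s \<subseteq> cbox a b" using ab by (auto simp: region_def)
  let ?F = "\<lambda>x. if x \<in> region d s then f x else 0"
  let ?J = "cbox ((a - (1 - s) *\<^sub>R d) /\<^sub>R s) ((b - (1 - s) *\<^sub>R d) /\<^sub>R s)"
  have "(?F has_integral integral (region d s) f) (cbox a b)"
    using int sub by (simp add: integrable_integral)
  from has_integral_affinity'[OF this s(1), of "(1 - s) *\<^sub>R d"]
  have "((\<lambda>x. if x \<in> T then f (s *\<^sub>R x + (1 - s) *\<^sub>R d) else 0)
       has_integral (integral (region d s) f /\<^sub>R s ^ DIM('a))) ?J"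
    by (simp add: homothety_region[OF d s])
  moreover have "T \<subseteq> ?J"
  proof
    fix x assume "x \<in> T"
    then have "s *\<^sub>R x + (1 - s) *\<^sub>R d \<in> cbox a b"
      using homothety_region[OF d s, of x] sub by blast
    then have "\<forall>i\<in>Basis. a \<bullet> i - (1 - s) * (d \<bullet> i) \<le> x \<bullet> i * s \<and> x \<bullet> i * s \<le> b \<bullet> i - (1 - s) * (d \<bullet> i)"
      by (auto simp: mem_box inner_add_left mult.commute[of s])
    then show "x \<in> ?J"
      using s by (simp add: mem_box inner_diff_left inverse_eq_divide pos_divide_le_eq pos_le_divide_eq)
  qed
  ultimately have "((\<lambda>x. f (s *\<^sub>R x + (1 - s) *\<^sub>R d)) has_integral (integral (region d s) f /\<^sub>R s ^ DIM('a))) T"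
    by simp
  from integral_unique[OF this]
  show "integral (region d s) f = s ^ DIM('a) * integral T (\<lambda>x. f (s *\<^sub>R x + (1 - s) *\<^sub>R d))"
    using s by simp
qed

text \<open>Let \<open>I\<close> and \<open>J\<close> be the integrals of \<open>f\<close> and of \<open>f\<close> times the coordinate of \<open>d\<close>, and let
  \<open>m = n + j\<close>. Shrinking the simplex towards \<open>d\<close> by \<open>s\<close> multiplies \<open>I\<close> by \<open>s\<^sup>m\<close> and
  turns \<open>J\<close> into \<open>s\<^sup>m ((1 - s) I + s J)\<close>. On the part that is left out the coordinate of \<open>d\<close> lies between \<open>0\<close>
  and \<open>1 - s\<close>, so \<open>J\<close> changes by at most \<open>(1 - s) (1 - s\<^sup>m) I\<close>. Dividing by \<open>1 - s\<close> and letting \<open>s\<close>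
  tend to \<open>1\<close> gives \<open>(m + 1) J = I\<close>. Applied with \<open>f = 1\<close> and with \<open>f\<close> another coordinate this yields all
  moments of order one and two, with homotheties as the only change of variables.\<close>

lemma integral_times_bary:
  fixes f :: "'a \<Rightarrow> real"
  assumes d: "d \<in> C" and f: "continuous_on UNIV f" and f0: "\<And>x. x \<in> T \<Longrightarrow> 0 \<le> f x"
    and hom: "\<And>x s. 0 < s \<Longrightarrow> s < 1 \<Longrightarrow> f (s *\<^sub>R x + (1 - s) *\<^sub>R d) = s ^ j * f x"
  shows "real (DIM('a) + j + 1) * integral T (\<lambda>x. f x * bary d x) = integral T f"
proof -
  define m where "m = DIM('a) + j"
  define I J where "I = integral T f" and "J = integral T (\<lambda>x. f x * bary d x)"
  have cfb: "continuous_on UNIV (\<lambda>x. f x * bary d x)"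
    by (intro continuous_intros f bary_continuous d)
  have fi: "f integrable_on T" and fbi: "(\<lambda>x. f x * bary d x) integrable_on T"
    by (rule integrable_on_compact_continuous[OF compact_simplex continuous_on_subset[OF f]], simp,
        rule integrable_on_compact_continuous[OF compact_simplex continuous_on_subset[OF cfb]], simp)
  have bounds: "s ^ m * I \<le> J * (\<Sum>i<m+1. s ^ i) \<and> J * (\<Sum>i<m+1. s ^ i) \<le> I" if s: "0 < s" "s < 1" for s
  proof -
    note reg = integral_region[OF d s]
    have rf: "integral (region d s) f = s ^ m * I"
      by (simp add: reg(2)[OF f] hom[OF s] m_def I_def power_add)
    have rfb: "integral (region d s) (\<lambda>x. f x * bary d x) = s ^ m * ((1 - s) * I + s * J)"
    proof -
      have "integral (region d s) (\<lambda>x. f x * bary d x)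
          = s ^ DIM('a) * integral T (\<lambda>x. s ^ j * ((1 - s) * f x + s * (f x * bary d x)))"
      proof -
        have "f (s *\<^sub>R x + (1 - s) *\<^sub>R d) * bary d (s *\<^sub>R x + (1 - s) *\<^sub>R d)
            = s ^ j * ((1 - s) * f x + s * (f x * bary d x))" for x
          unfolding hom[OF s] bary_combination[OF d] bary_vertex[OF d d] by (simp add: algebra_simps)
        then show ?thesis by (simp only: reg(2)[OF cfb])
      qed
      also have "integral T (\<lambda>x. s ^ j * ((1 - s) * f x + s * (f x * bary d x)))
          = s ^ j * ((1 - s) * I + s * J)"
        unfolding I_def J_def using fi fbi
        by (simp add: integral_add integrable_on_mult_right)
      finally show ?thesis by (simp add: m_def power_add)
    qed
    have sub: "region d s \<subseteq> T" by (auto simp: region_def)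
    let ?\<chi> = "\<lambda>g x. if x \<in> region d s then g x else 0 :: real"
    have \<chi>: "?\<chi> g integrable_on T" "integral T (?\<chi> g) = integral (region d s) g"
      if "continuous_on UNIV g" for g
    proof -
      have "(?\<chi> g has_integral integral (region d s) g) T"
        using reg(1)[OF that] sub by (simp add: integrable_integral)
      then show "?\<chi> g integrable_on T" "integral T (?\<chi> g) = integral (region d s) g" by blast+
    qed
    have b0: "0 \<le> bary d x" if "x \<in> T" for x using that d by (simp add: simplex_eq)
    have "integral T (?\<chi> (\<lambda>x. f x * bary d x)) \<le> J" unfolding J_def
      by (rule integral_le[OF \<chi>(1)[OF cfb] fbi]) (use f0 b0 in auto)
    then have low: "s ^ m * ((1 - s) * I + s * J) \<le> J" by (simp add: \<chi>(2)[OF cfb] rfb)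
    have "integral T (\<lambda>x. f x * bary d x + (1 - s) * ?\<chi> f x) \<le> integral T (\<lambda>x. (1 - s) * f x + ?\<chi> (\<lambda>x. f x * bary d x) x)"
    proof (rule integral_le)
      show "(\<lambda>x. f x * bary d x + (1 - s) * ?\<chi> f x) integrable_on T"
        by (intro integrable_add fbi integrable_on_mult_right \<chi>(1) f)
      show "(\<lambda>x. (1 - s) * f x + ?\<chi> (\<lambda>x. f x * bary d x) x) integrable_on T"
        by (intro integrable_add fi integrable_on_mult_right \<chi>(1) cfb)
      fix x assume x: "x \<in> T"
      show "f x * bary d x + (1 - s) * ?\<chi> f x \<le> (1 - s) * f x + ?\<chi> (\<lambda>x. f x * bary d x) x"
      proof (cases "x \<in> region d s")
        case False
        then have "bary d x \<le> 1 - s" using x by (auto simp: region_def)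
        then show ?thesis using False mult_right_mono[OF \<open>bary d x \<le> 1 - s\<close> f0[OF x]]
            by (simp add: mult.commute)
      qed simp
    qed
    also have "integral T (\<lambda>x. f x * bary d x + (1 - s) * ?\<chi> f x) = J + (1 - s) * (s ^ m * I)"
    proof -
      have "integral T (\<lambda>x. f x * bary d x + (1 - s) * ?\<chi> f x) = J + integral T (\<lambda>x. (1 - s) * ?\<chi> f x)"
        unfolding J_def by (rule integral_add[OF fbi integrable_on_mult_right[OF \<chi>(1)[OF f]]])
      then show ?thesis by (simp only: integral_mult_right \<chi>(2)[OF f] rf)
    qed
    also have "integral T (\<lambda>x. (1 - s) * f x + ?\<chi> (\<lambda>x. f x * bary d x) x)
       = (1 - s) * I + s ^ m * ((1 - s) * I + s * J)"
    proof -
      have "integral T (\<lambda>x. (1 - s) * f x + ?\<chi> (\<lambda>x. f x * bary d x) x)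
         = integral T (\<lambda>x. (1 - s) * f x) + integral T (?\<chi> (\<lambda>x. f x * bary d x))"
        by (rule integral_add[OF integrable_on_mult_right[OF fi] \<chi>(1)[OF cfb]])
      then show ?thesis by (simp only: integral_mult_right \<chi>(2)[OF cfb] rfb I_def)
    qed
    finally have high: "J + (1 - s) * (s ^ m * I) \<le> (1 - s) * I + s ^ m * ((1 - s) * I + s * J)" .
    have gp: "J * (1 - s ^ (m + 1)) = (1 - s) * (J * (\<Sum>i<m+1. s ^ i))"
      unfolding one_diff_power_eq by simp
    have "(1 - s) * (s ^ m * I) \<le> (1 - s) * (J * (\<Sum>i<m+1. s ^ i))"
      unfolding gp[symmetric] using low by (simp add: algebra_simps)
    moreover have "(1 - s) * (J * (\<Sum>i<m+1. s ^ i)) \<le> (1 - s) * I"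
      unfolding gp[symmetric] using high by (simp add: algebra_simps)
    ultimately show ?thesis using s by (simp only: mult_le_cancel_left_pos diff_gt_0_iff_gt)
  qed
  have ev: "\<forall>\<^sub>F s in at_left (1::real). 0 < s \<and> s < 1"
    unfolding eventually_at_left_field by (intro exI[of _ 0]) auto
  have lim: "((\<lambda>s. J * (\<Sum>i<m+1. s ^ i)) \<longlongrightarrow> J * (\<Sum>i<m+1. 1 ^ i)) (at_left 1)"
    by (intro tendsto_intros)
  have lim': "((\<lambda>s. s ^ m * I) \<longlongrightarrow> 1 ^ m * I) (at_left 1)"
    by (intro tendsto_intros)
  have "J * (\<Sum>i<m+1. 1 ^ i) \<le> I"
    by (rule tendsto_upperbound[OF lim]) (use ev bounds in \<open>auto elim: eventually_mono\<close>)
  moreover have "1 ^ m * I \<le> J * (\<Sum>i<m+1. 1 ^ i)"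
    by (rule tendsto_le[OF _ lim lim']) (use ev bounds in \<open>auto elim: eventually_mono\<close>)
  ultimately have "J * real (m + 1) = I" by simp
  then show ?thesis by (simp add: I_def J_def m_def mult.commute)
qed

lemma integral_bary:
  assumes d: "d \<in> C"
  shows "real (DIM('a) + 1) * integral T (bary d) = measure lebesgue T"
  using integral_times_bary[OF d, of "\<lambda>_. 1" 0]
  by (simp add: lmeasure_integral[OF lmeasurable_compact[OF compact_simplex]])

lemma bary_integrable: "c \<in> C \<Longrightarrow> bary c integrable_on T"
  by (rule integrable_on_compact_continuous[OF compact_simplex bary_continuous])

lemma bary_mult_integrable: "c \<in> C \<Longrightarrow> d \<in> C \<Longrightarrow> (\<lambda>x. bary c x * bary d x) integrable_on T"
  by (rule integrable_on_compact_continuous[OF compact_simplex]) (intro continuous_intros bary_continuous)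

text \<open>For \<open>c \<noteq> d\<close> the coordinate of \<open>c\<close> is homogeneous of degree one about \<open>d\<close>. The diagonal
  case then follows because the coordinates sum to one.\<close>

lemma integral_bary_mult:
  assumes c: "c \<in> C" and d: "d \<in> C"
  shows "real ((DIM('a) + 1) * (DIM('a) + 2)) * integral T (\<lambda>x. bary c x * bary d x)
     = (if c = d then 2 else 1) * measure lebesgue T"
proof -
  have off: "real ((DIM('a) + 1) * (DIM('a) + 2)) * integral T (\<lambda>x. bary c x * bary d x)
     = measure lebesgue T" if "c \<in> C" "c \<noteq> d" for c
  proof -
    have "real (DIM('a) + 1 + 1) * integral T (\<lambda>x. bary c x * bary d x) = integral T (bary c)"
    proof (rule integral_times_bary[OF d bary_continuous[OF that(1)]])
      show "0 \<le> bary c x" if "x \<in> T" for x using that \<open>c \<in> C\<close> by (simp add: simplex_eq)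
      show "bary c (s *\<^sub>R x + (1 - s) *\<^sub>R d) = s ^ 1 * bary c x" for x s
        using that by (simp add: bary_combination bary_vertex d)
    qed
    then show ?thesis using integral_bary[OF that(1)] by (simp only: of_nat_mult mult.assoc) simp
  qed
  show ?thesis
  proof (cases "c = d")
    case False then show ?thesis using off[OF c] by simp
  next
    case True
    let ?P = "real ((DIM('a) + 1) * (DIM('a) + 2))"
    have "bary d x = (\<Sum>c\<in>C. bary c x * bary d x)" for x
      by (simp add: bary_decomposition flip: sum_distrib_right)
    then have "integral T (bary d) = integral T (\<lambda>x. \<Sum>c\<in>C. bary c x * bary d x)" by presburger
    also have "\<dots> = (\<Sum>c\<in>C. integral T (\<lambda>x. bary c x * bary d x))"
      by (rule integral_sum[OF finite_C]) (rule bary_mult_integrable[OF _ d])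
    also have "\<dots> = integral T (\<lambda>x. bary d x * bary d x) + (\<Sum>c\<in>C - {d}. integral T (\<lambda>x. bary c x * bary d x))"
      by (rule sum.remove[OF finite_C d])
    finally have "?P * integral T (bary d) = ?P * integral T (\<lambda>x. bary d x * bary d x)
        + (\<Sum>c\<in>C - {d}. ?P * integral T (\<lambda>x. bary c x * bary d x))"
      by (simp only: distrib_left sum_distrib_left)
    also have "(\<Sum>c\<in>C - {d}. ?P * integral T (\<lambda>x. bary c x * bary d x)) = (\<Sum>c\<in>C - {d}. measure lebesgue T)"
      by (rule sum.cong) (use off in auto)
    also have "\<dots> = real DIM('a) * measure lebesgue T" using card_C d finite_C by simp
    also have "?P * integral T (bary d) = real (DIM('a) + 2) * measure lebesgue T"
    proof -
      have "?P * integral T (bary d) = real (DIM('a) + 2) * (real (DIM('a) + 1) * integral T (bary d))"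
        by (simp only: of_nat_mult ac_simps)
      then show ?thesis by (simp only: integral_bary[OF d])
    qed
    finally show ?thesis using True by (simp add: algebra_simps)
  qed
qed

lemma integral_affine:
  assumes v: "\<And>x. x \<in> T \<Longrightarrow> v x = k \<bullet> x + (e :: real)"
  shows "(v has_integral (measure lebesgue T / real (DIM('a) + 1) * (\<Sum>c\<in>C. v c))) T"
proof -
  have "((\<lambda>x. \<Sum>c\<in>C. v c * bary c x) has_integral (\<Sum>c\<in>C. v c * integral T (bary c))) T"
    by (intro has_integral_sum finite_C has_integral_mult_right integrable_integral bary_integrable)
  moreover have "(\<Sum>c\<in>C. v c * integral T (bary c)) = measure lebesgue T / real (DIM('a) + 1) * (\<Sum>c\<in>C. v c)"
    unfolding sum_distrib_left
  proof (rule sum.cong)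
    fix c assume "c \<in> C"
    from integral_bary[OF this] have "integral T (bary c) = measure lebesgue T / real (DIM('a) + 1)"
      by (simp add: field_simps)
    then show "v c * integral T (bary c) = measure lebesgue T / real (DIM('a) + 1) * v c" by simp
  qed simp
  ultimately show ?thesis using has_integral_eq[of T "\<lambda>x. \<Sum>c\<in>C. v c * bary c x" v]
    affine_on_simplex[OF _ v] by simp
qed

lemma integral_affine_mult:
  assumes v: "\<And>x. x \<in> T \<Longrightarrow> v x = k \<bullet> x + (e :: real)" and w: "\<And>x. x \<in> T \<Longrightarrow> w x = k' \<bullet> x + (e' :: real)"
  shows "((\<lambda>x. v x * w x) has_integral (measure lebesgue T / real ((DIM('a) + 1) * (DIM('a) + 2))
      * ((\<Sum>c\<in>C. v c * w c) + (\<Sum>c\<in>C. v c) * (\<Sum>c\<in>C. w c)))) T"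
proof -
  have "((\<lambda>x. \<Sum>c\<in>C. \<Sum>d\<in>C. v c * w d * (bary c x * bary d x)) has_integral
     (\<Sum>c\<in>C. \<Sum>d\<in>C. v c * w d * integral T (\<lambda>x. bary c x * bary d x))) T"
    by (intro has_integral_sum finite_C has_integral_mult_right integrable_integral bary_mult_integrable)
  moreover have "(\<Sum>c\<in>C. \<Sum>d\<in>C. v c * w d * integral T (\<lambda>x. bary c x * bary d x))
    = measure lebesgue T / real ((DIM('a) + 1) * (DIM('a) + 2))
      * ((\<Sum>c\<in>C. v c * w c) + (\<Sum>c\<in>C. v c) * (\<Sum>c\<in>C. w c))"
  proof -
    let ?r = "measure lebesgue T / real ((DIM('a) + 1) * (DIM('a) + 2))"
    have "(\<Sum>c\<in>C. \<Sum>d\<in>C. v c * w d * integral T (\<lambda>x. bary c x * bary d x))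
        = (\<Sum>c\<in>C. \<Sum>d\<in>C. ?r * (if c = d then v c * w d else 0) + ?r * (v c * w d))"
    proof (intro sum.cong refl)
      fix c d assume "c \<in> C" "d \<in> C"
      from integral_bary_mult[OF this]
      have "integral T (\<lambda>x. bary c x * bary d x) = ?r * (if c = d then 2 else 1)"
        by (simp add: nonzero_eq_divide_eq mult.commute del: of_nat_mult of_nat_add)
      then show "v c * w d * integral T (\<lambda>x. bary c x * bary d x)
         = ?r * (if c = d then v c * w d else 0) + ?r * (v c * w d)"
        by (simp del: of_nat_mult of_nat_add)
    qed
    also have "\<dots> = ?r * ((\<Sum>c\<in>C. v c * w c) + (\<Sum>c\<in>C. v c) * (\<Sum>c\<in>C. w c))"
    proof -
      have "(\<Sum>c\<in>C. \<Sum>d\<in>C. r * (if c = d then v c * w d else 0) + r * (v c * w d))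
          = r * ((\<Sum>c\<in>C. \<Sum>d\<in>C. if c = d then v c * w d else 0) + (\<Sum>c\<in>C. \<Sum>d\<in>C. v c * w d))" for r
        by (simp only: sum.distrib sum_distrib_left[symmetric] distrib_left)
      moreover have "(\<Sum>c\<in>C. \<Sum>d\<in>C. if c = d then v c * w d else 0) = (\<Sum>c\<in>C. v c * w c)"
        by (simp add: finite_C)
      ultimately show ?thesis by (simp only: sum_product)
    qed
    finally show ?thesis .
  qed
  moreover have "(\<Sum>c\<in>C. \<Sum>d\<in>C. v c * w d * (bary c x * bary d x)) = v x * w x" if "x \<in> T" for x
    unfolding affine_on_simplex[OF that v, simplified] affine_on_simplex[OF that w, simplified] sum_product
    by (simp add: algebra_simps)
  ultimately show ?thesis
    using has_integral_eq[of T "\<lambda>x. \<Sum>c\<in>C. \<Sum>d\<in>C. v c * w d * (bary c x * bary d x)" "\<lambda>x. v x * w x"] by simp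
qed

end

section \<open>Comparison of the mass matrix and the lumped mass matrix\<close>

lemma full_dimensional_simplex:
  fixes T :: "'a::euclidean_space set"
  assumes "int DIM('a) simplex T"
  shows "full_simplex {c. c extreme_point_of T}" and "T = convex hull {c. c extreme_point_of T}"
    and "interior T \<noteq> {}"
proof -
  obtain C where C: "\<not> affine_dependent C" "int (card C) = int DIM('a) + 1" "T = convex hull C"
    using assms by (auto simp: simplex_def)
  have ext: "{c. c extreme_point_of T} = C"
    using extreme_point_of_convex_hull_affine_independent[OF C(1)] C(3) by auto
  show "full_simplex {c. c extreme_point_of T}" unfolding ext
    by unfold_locales (use C in auto)
  show "T = convex hull {c. c extreme_point_of T}" unfolding ext by (rule C(3))
  have "aff_dim T = DIM('a)" by (rule aff_dim_simplex[OF assms])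
  then have "affine hull T = UNIV" using aff_dim_eq_full by blast
  moreover have "T \<noteq> {}" using \<open>aff_dim T = DIM('a)\<close> by auto
  ultimately show "interior T \<noteq> {}"
    using rel_interior_eq_empty[of T] rel_interior_interior[of T] C(3) by auto
qed

text \<open>Two cells meet in a proper face of both, and the interior of the mesh differs from the union
  of the cells only by boundary points of cells; both sets are null sets, so the integral can be
  assembled cell by cell.\<close>

lemma integral_mesh_interior:
  fixes f :: "real^'n::finite \<Rightarrow> real"
  assumes tri: "triangulation \<T>" and cells: "\<And>T. T \<in> \<T> \<Longrightarrow> int CARD('n) simplex T"
    and f: "continuous_on (\<Union>\<T>) f" and i: "\<And>T. T \<in> \<T> \<Longrightarrow> (f has_integral i T) T"
  shows "integrable (lebesgue_on (mesh_interior \<T>)) f"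
    and "integral\<^sup>L (lebesgue_on (mesh_interior \<T>)) f = sum i \<T>"
proof -
  have fin: "finite \<T>" using tri by (simp add: triangulation_def)
  have conv: "convex T" and comp: "compact T" if "T \<in> \<T>" for T
    using cells[OF that] convex_simplex compact_simplex by blast+
  have U: "compact (\<Union>\<T>)" using fin comp by blast
  have neg: "negligible (S \<inter> S')" if S: "S \<in> \<T>" "S' \<in> \<T>" "S \<noteq> S'" for S S'
  proof -
    have face: "(S \<inter> S') face_of S" "(S \<inter> S') face_of S'"
      using tri S unfolding triangulation_def by (blast, metis Int_commute)
    have dim: "aff_dim S = CARD('n)" "aff_dim S' = CARD('n)"
      using aff_dim_simplex cells S by blast+
    have "aff_dim (S \<inter> S') < CARD('n)"
    proof (cases "S \<inter> S' = S")
      case True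
      then show ?thesis using face_of_aff_dim_lt[OF conv[OF S(2)] face(2)] S(3) dim by auto
    next
      case False
      then show ?thesis using face_of_aff_dim_lt[OF conv[OF S(1)] face(1)] dim by auto
    qed
    then have "interior (S \<inter> S') = {}" using aff_dim_nonempty_interior[of "S \<inter> S'"] by force
    then show ?thesis using negligible_convex_interior convex_Int[OF conv[OF S(1)] conv[OF S(2)]] by blast
  qed
  have sum: "(f has_integral sum i \<T>) (\<Union>\<T>)"
    by (rule has_integral_Union[OF fin i]) (auto simp: pairwise_def intro: neg)
  have sub: "mesh_interior \<T> \<subseteq> \<Union>\<T>" by (simp add: mesh_interior_def interior_subset)
  have meas: "mesh_interior \<T> \<in> sets borel" by (simp add: mesh_interior_def)
  have "negligible (\<Union>\<T> - mesh_interior \<T>)"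
  proof (rule negligible_subset)
    show "negligible (\<Union>T\<in>\<T>. frontier T)"
      using fin conv negligible_convex_frontier by blast
    show "\<Union>\<T> - mesh_interior \<T> \<subseteq> (\<Union>T\<in>\<T>. frontier T)"
    proof
      fix x assume x: "x \<in> \<Union>\<T> - mesh_interior \<T>"
      then obtain T where T: "T \<in> \<T>" "x \<in> T" by blast
      have "interior T \<subseteq> mesh_interior \<T>" unfolding mesh_interior_def
        by (rule interior_mono) (use T in blast)
      then have "x \<in> frontier T" using x T closure_subset by (auto simp: frontier_def)
      then show "x \<in> (\<Union>T\<in>\<T>. frontier T)" using T by blast
    qed
  qed
  then have eq: "integral (mesh_interior \<T>) f = sum i \<T>"
    using integral_subset_negligible[OF sub] integral_unique[OF sum] by metis
  have "set_integrable lborel (\<Union>\<T>) f"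
    using borel_integrable_compact[OF U f] by (simp add: set_integrable_def)
  then have "set_integrable lborel (mesh_interior \<T>) f"
    by (rule set_integrable_subset) (use meas sub in auto)
  then have "integrable lebesgue (\<lambda>x. indicator (mesh_interior \<T>) x *\<^sub>R f x)"
    unfolding set_integrable_def by (intro integrable_completion[THEN iffD2]) auto
  then show int: "integrable (lebesgue_on (mesh_interior \<T>)) f"
    using meas by (subst integrable_restrict_space) auto
  show "integral\<^sup>L (lebesgue_on (mesh_interior \<T>)) f = sum i \<T>"
    using lebesgue_integral_eq_integral[OF int] meas eq by simp
qed

locale nodal_mesh =
  fixes \<Omega> :: "(real^'n::finite) set" and \<T> :: "(real^'n) set set" and \<phi> :: "'N::finite \<Rightarrow> real^'n \<Rightarrow> real"
  assumes tri: "triangulation \<T>" and cells: "\<And>T. T \<in> \<T> \<Longrightarrow> int CARD('n) simplex T"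
    and sub: "mesh_interior \<T> \<subseteq> \<Omega>" and basis: "nodal_basis \<Omega> \<T> \<phi>"
begin

lemma simplex_subset_closure: "T \<in> \<T> \<Longrightarrow> T \<subseteq> closure \<Omega>"
proof -
  assume T: "T \<in> \<T>"
  have s: "int DIM(real^'n) simplex T" using cells[OF T] by simp
  have "T \<subseteq> closure T" by (rule closure_subset)
  also have "closure T = closure (interior T)"
    using convex_closure_interior[OF convex_simplex[OF s] full_dimensional_simplex(3)[OF s]] by simp
  also have "\<dots> \<subseteq> closure \<Omega>"
  proof (rule closure_mono)
    have "interior T \<subseteq> mesh_interior \<T>"
      unfolding mesh_interior_def by (rule interior_mono) (use T in blast)
    then show "interior T \<subseteq> \<Omega>" using sub by blast
  qed
  finally show ?thesis .
qed

lemma basis_continuous: "continuous_on (\<Union>\<T>) (\<phi> i)"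
proof (rule continuous_on_subset)
  show "continuous_on (closure \<Omega>) (\<phi> i)"
    using basis by (auto simp: nodal_basis_def fe_space_def)
qed (use simplex_subset_closure in blast)

lemma combination_affine:
  assumes "T \<in> \<T>"
  shows "\<exists>k e. \<forall>x\<in>T. (\<Sum>i\<in>UNIV. r i * \<phi> i x) = k \<bullet> x + e"
proof -
  have "\<forall>i. \<exists>d e. \<forall>x\<in>T. \<phi> i x = d \<bullet> x + e"
    using basis assms by (auto simp: nodal_basis_def fe_space_def)
  then obtain d e where "\<And>i x. x \<in> T \<Longrightarrow> \<phi> i x = d i \<bullet> x + e i" by metis
  then have "\<forall>x\<in>T. (\<Sum>i\<in>UNIV. r i * \<phi> i x) = (\<Sum>i\<in>UNIV. r i *\<^sub>R d i) \<bullet> x + (\<Sum>i\<in>UNIV. r i * e i)"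
    by (simp add: inner_sum_left distrib_left sum.distrib)
  then show ?thesis by blast
qed

text \<open>A node outside the interior of the mesh still lies in the closure of \<open>\<Omega>\<close>, where
  elements of the discrete space vanish off the mesh interior. So at every vertex of every cell at most one basis
  function is nonzero, and there the square of a combination is the combination of the squares;
  this is what makes lumping a quadrature of \<open>v\<^sup>2\<close> in the vertices.\<close>

lemma basis_at_node:
  assumes "c \<in> mesh_nodes \<T>"
  shows "(\<forall>i. \<phi> i c = 0) \<or> (\<exists>j. \<forall>i. \<phi> i c = (if i = j then 1 else 0))"
proof (cases "c \<in> mesh_interior \<T>")
  case True
  then show ?thesis using basis assms unfolding nodal_basis_def bij_betw_def
    by (metis (no_types, lifting) Int_iff imageE)
next
  case False
  obtain T where "T \<in> \<T>" "c extreme_point_of T" using assms by (auto simp: mesh_nodes_def)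
  then have "c \<in> closure \<Omega>" using simplex_subset_closure by (auto simp: extreme_point_of_def)
  then have "\<phi> i c = 0" for i using False basis by (auto simp: nodal_basis_def fe_space_def)
  then show ?thesis by blast
qed

abbreviation vertices :: "(real^'n) set \<Rightarrow> (real^'n) set" where
  "vertices T \<equiv> {c. c extreme_point_of T}"

abbreviation weight :: "(real^'n) set \<Rightarrow> real" where
  "weight T \<equiv> measure lebesgue T / real (CARD('n) + 1)"

abbreviation nodal_value :: "real^'N \<Rightarrow> real^'n \<Rightarrow> real" where
  "nodal_value x c \<equiv> \<Sum>i\<in>UNIV. x $ i * \<phi> i c"

lemma sqnorm_mass_matrix:
  fixes x :: "real^'N"
  shows "sqnorm (mass_matrix \<T> \<phi>) x = (\<Sum>T\<in>\<T>. weight T / real (CARD('n) + 2)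
     * ((\<Sum>c\<in>vertices T. (nodal_value x c)\<^sup>2) + (\<Sum>c\<in>vertices T. nodal_value x c)\<^sup>2))"
proof -
  let ?i = "\<lambda>v w T. measure lebesgue T / real ((CARD('n) + 1) * (CARD('n) + 2))
      * ((\<Sum>c\<in>vertices T. v c * w c) + (\<Sum>c\<in>vertices T. v c) * (\<Sum>c\<in>vertices T. w c))"
  have prod: "((\<lambda>p. (\<Sum>i\<in>UNIV. r i * \<phi> i p) * (\<Sum>i\<in>UNIV. s i * \<phi> i p)) has_integral
       ?i (\<lambda>p. \<Sum>i\<in>UNIV. r i * \<phi> i p) (\<lambda>p. \<Sum>i\<in>UNIV. s i * \<phi> i p) T) T" if T: "T \<in> \<T>" for r s T
  proof -
    have sm: "int DIM(real^'n) simplex T" using cells[OF T] by simp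
    interpret full_simplex "vertices T" by (rule full_dimensional_simplex(1)[OF sm])
    note hull = full_dimensional_simplex(2)[OF sm]
    obtain k e where 1: "\<And>x. x \<in> T \<Longrightarrow> (\<Sum>i\<in>UNIV. r i * \<phi> i x) = k \<bullet> x + e"
      using combination_affine[OF T] by blast
    obtain k' e' where 2: "\<And>x. x \<in> T \<Longrightarrow> (\<Sum>i\<in>UNIV. s i * \<phi> i x) = k' \<bullet> x + e'"
      using combination_affine[OF T] by blast
    show ?thesis
      using integral_affine_mult[of "\<lambda>p. \<Sum>i\<in>UNIV. r i * \<phi> i p" k e "\<lambda>p. \<Sum>i\<in>UNIV. s i * \<phi> i p" k' e']
      1 2 hull[symmetric] by simp
  qed
  \<comment> \<open>Unit coefficient vectors recover the single basis functions.\<close>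
  have single: "(\<Sum>l\<in>UNIV. (if l = i then 1 else 0) * \<phi> l p) = \<phi> i p" for i p
    by (simp add: if_distrib[of "\<lambda>r. r * _"] cong: if_cong)
  have int: "integrable (lebesgue_on (mesh_interior \<T>)) (\<lambda>p. \<phi> i p * \<phi> j p)" for i j
    by (rule integral_mesh_interior(1)[OF tri cells _
          prod[of _ "\<lambda>l. if l = i then 1 else 0" "\<lambda>l. if l = j then 1 else 0", unfolded single]])
      (auto intro!: continuous_intros basis_continuous)
  have "sqnorm (mass_matrix \<T> \<phi>) x = (\<Sum>i\<in>UNIV. \<Sum>j\<in>UNIV.
      x $ i * x $ j * integral\<^sup>L (lebesgue_on (mesh_interior \<T>)) (\<lambda>p. \<phi> i p * \<phi> j p))"
    by (simp add: sqnorm_def inner_vec_def matrix_vector_mult_def mass_matrix_def sum_distrib_left ac_simps)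
  also have "\<dots> = integral\<^sup>L (lebesgue_on (mesh_interior \<T>)) (\<lambda>p. \<Sum>i\<in>UNIV. \<Sum>j\<in>UNIV. x $ i * x $ j * (\<phi> i p * \<phi> j p))"
    by (simp add: Bochner_Integration.integral_sum Bochner_Integration.integrable_sum int)
  also have "(\<lambda>p. \<Sum>i\<in>UNIV. \<Sum>j\<in>UNIV. x $ i * x $ j * (\<phi> i p * \<phi> j p)) = (\<lambda>p. nodal_value x p * nodal_value x p)"
    by (simp add: sum_product fun_eq_iff ac_simps)
  also have "integral\<^sup>L (lebesgue_on (mesh_interior \<T>)) \<dots> = (\<Sum>T\<in>\<T>. ?i (nodal_value x) (nodal_value x) T)"
    by (rule integral_mesh_interior(2)[OF tri cells _ prod])
      (auto intro!: continuous_intros basis_continuous)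
  finally show ?thesis by (simp only: power2_eq_square of_nat_mult divide_divide_eq_left)
qed

text \<open>The form of the lumped matrix integrates the finite element function with the squared
  coefficients. At the vertices this function agrees with the square of the function with
  coefficients \<open>x\<close>.\<close>

lemma sqnorm_lumped_mass_matrix:
  fixes x :: "real^'N"
  shows "sqnorm (lumped_mass_matrix \<T> \<phi>) x = (\<Sum>T\<in>\<T>. weight T * (\<Sum>c\<in>vertices T. (nodal_value x c)\<^sup>2))"
proof -
  have lin: "((\<lambda>p. \<Sum>i\<in>UNIV. r i * \<phi> i p) has_integral weight T * (\<Sum>c\<in>vertices T. \<Sum>i\<in>UNIV. r i * \<phi> i c)) T"
    if T: "T \<in> \<T>" for r T
  proof -
    have sm: "int DIM(real^'n) simplex T" using cells[OF T] by simp
    interpret full_simplex "vertices T" by (rule full_dimensional_simplex(1)[OF sm])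
    note hull = full_dimensional_simplex(2)[OF sm]
    obtain k e where 1: "\<And>x. x \<in> T \<Longrightarrow> (\<Sum>i\<in>UNIV. r i * \<phi> i x) = k \<bullet> x + e"
      using combination_affine[OF T] by blast
    show ?thesis
      using integral_affine[of "\<lambda>p. \<Sum>i\<in>UNIV. r i * \<phi> i p" k e] 1 hull[symmetric] by simp
  qed
  \<comment> \<open>Unit coefficient vectors recover the single basis functions.\<close>
  have single: "(\<Sum>l\<in>UNIV. (if l = i then 1 else 0) * \<phi> l p) = \<phi> i p" for i p
    by (simp add: if_distrib[of "\<lambda>r. r * _"] cong: if_cong)
  have int: "integrable (lebesgue_on (mesh_interior \<T>)) (\<phi> i)" for i
    by (rule integral_mesh_interior(1)[OF tri cells basis_continuous
          lin[of _ "\<lambda>l. if l = i then 1 else 0", unfolded single]])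
  have "sqnorm (lumped_mass_matrix \<T> \<phi>) x = (\<Sum>i\<in>UNIV. (x $ i)\<^sup>2 * integral\<^sup>L (lebesgue_on (mesh_interior \<T>)) (\<phi> i))"
    by (simp add: sqnorm_def inner_vec_def matrix_vector_mult_def lumped_mass_matrix_def power2_eq_square
        if_distrib[of "\<lambda>r. _ * r"] ac_simps cong: if_cong)
  also have "\<dots> = integral\<^sup>L (lebesgue_on (mesh_interior \<T>)) (\<lambda>p. \<Sum>i\<in>UNIV. (x $ i)\<^sup>2 * \<phi> i p)"
    by (simp add: Bochner_Integration.integral_sum int)
  also have "\<dots> = (\<Sum>T\<in>\<T>. weight T * (\<Sum>c\<in>vertices T. \<Sum>i\<in>UNIV. (x $ i)\<^sup>2 * \<phi> i c))"
    by (rule integral_mesh_interior(2)[OF tri cells _ lin])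
      (auto intro!: continuous_intros basis_continuous)
  also have "\<dots> = (\<Sum>T\<in>\<T>. weight T * (\<Sum>c\<in>vertices T. (nodal_value x c)\<^sup>2))"
  proof (intro sum.cong refl arg_cong2[where f = "(*)"])
    fix T c assume "T \<in> \<T>" "c \<in> vertices T"
    then have "c \<in> mesh_nodes \<T>" by (auto simp: mesh_nodes_def)
    from basis_at_node[OF this]
    show "(\<Sum>i\<in>UNIV. (x $ i)\<^sup>2 * \<phi> i c) = (nodal_value x c)\<^sup>2"
      by (auto simp: if_distrib[of "\<lambda>r. _ * r"] cong: if_cong)
  qed
  finally show ?thesis .
qed

lemma vertices_finite_card: "T \<in> \<T> \<Longrightarrow> finite (vertices T) \<and> card (vertices T) = CARD('n) + 1"
  using full_dimensional_simplex(1)[of T] cells[of T] full_simplex.finite_C full_simplex.card_C by fastforce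

lemma weight_pos: "T \<in> \<T> \<Longrightarrow> 0 < weight T"
proof -
  assume T: "T \<in> \<T>"
  have s: "int DIM(real^'n) simplex T" using cells[OF T] by simp
  have "\<not> negligible T"
    using full_dimensional_simplex(3)[OF s] negligible_convex_interior[OF convex_simplex[OF s]] by blast
  moreover have "T \<in> lmeasurable" by (rule lmeasurable_compact[OF compact_simplex[OF s]])
  ultimately have "measure lebesgue T \<noteq> 0" using negligible_iff_measure0 by blast
  then show ?thesis by (simp add: less_le)
qed

text \<open>Cellwise, this is the Cauchy-Schwarz inequality for the \<open>n + 1\<close> vertex values.\<close>

lemma mass_matrix_le_lumped:
  fixes x :: "real^'N"
  shows "sqnorm (mass_matrix \<T> \<phi>) x \<le> sqnorm (lumped_mass_matrix \<T> \<phi>) x"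
  unfolding sqnorm_mass_matrix sqnorm_lumped_mass_matrix
proof (rule sum_mono)
  fix T assume T: "T \<in> \<T>"
  let ?q = "\<Sum>c\<in>vertices T. (nodal_value x c)\<^sup>2"
  have "(\<Sum>c\<in>vertices T. nodal_value x c)\<^sup>2 \<le> ?q * card (vertices T)"
    by (rule sum_squared_le_sum_of_squares)
  then have "?q + (\<Sum>c\<in>vertices T. nodal_value x c)\<^sup>2 \<le> real (CARD('n) + 2) * ?q"
    using vertices_finite_card[OF T] by (simp add: algebra_simps)
  from mult_left_mono[OF this, of "weight T / real (CARD('n) + 2)"] weight_pos[OF T]
  show "weight T / real (CARD('n) + 2) * (?q + (\<Sum>c\<in>vertices T. nodal_value x c)\<^sup>2) \<le> weight T * ?q"
    by simp
qed

text \<open>Cellwise, the square of the sum of the vertex values is dropped; the constant is therefore attained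
  by functions whose vertex values sum to zero on every cell.\<close>

lemma lumped_le_mass_matrix:
  fixes x :: "real^'N"
  shows "sqnorm (lumped_mass_matrix \<T> \<phi>) x \<le> real (CARD('n) + 2) * sqnorm (mass_matrix \<T> \<phi>) x"
  unfolding sqnorm_mass_matrix sqnorm_lumped_mass_matrix sum_distrib_left[of "real (CARD('n) + 2)"]
proof (rule sum_mono)
  fix T assume T: "T \<in> \<T>"
  have "weight T * (\<Sum>c\<in>vertices T. (nodal_value x c)\<^sup>2)
      \<le> weight T * ((\<Sum>c\<in>vertices T. (nodal_value x c)\<^sup>2) + (\<Sum>c\<in>vertices T. nodal_value x c)\<^sup>2)"
    by (rule mult_left_mono) (use weight_pos[OF T] in auto)
  then show "weight T * (\<Sum>c\<in>vertices T. (nodal_value x c)\<^sup>2) \<le> real (CARD('n) + 2) * (weight T / real (CARD('n) + 2) *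
     ((\<Sum>c\<in>vertices T. (nodal_value x c)\<^sup>2) + (\<Sum>c\<in>vertices T. nodal_value x c)\<^sup>2))"
    by simp
qed

lemma mass_matrix_pos:
  fixes x :: "real^'N"
  assumes "x \<noteq> 0"
  shows "0 < sqnorm (mass_matrix \<T> \<phi>) x"
proof -
  obtain j where j: "x $ j \<noteq> 0" using assms by (auto simp: vec_eq_iff)
  obtain node :: "'N \<Rightarrow> real^'n" where node: "bij_betw node UNIV (mesh_nodes \<T> \<inter> mesh_interior \<T>)"
    "\<forall>i j. \<phi> i (node j) = (if i = j then 1 else 0)"
    using basis by (auto simp: nodal_basis_def)
  have "node j \<in> mesh_nodes \<T>" using node(1) by (auto simp: bij_betw_def)
  then obtain T where T: "T \<in> \<T>" "node j \<in> vertices T" by (auto simp: mesh_nodes_def)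
  have "nodal_value x (node j) = x $ j"
    by (simp add: node(2) if_distrib[of "\<lambda>r. _ * r"] cong: if_cong)
  then have "0 < (\<Sum>c\<in>vertices T. (nodal_value x c)\<^sup>2)"
    using j T vertices_finite_card[OF T(1)] by (intro sum_pos2[of _ "node j"]) auto
  then have "0 < weight T * (\<Sum>c\<in>vertices T. (nodal_value x c)\<^sup>2)" by (rule mult_pos_pos[OF weight_pos[OF T(1)]])
  note pos = this
  have "0 < sqnorm (lumped_mass_matrix \<T> \<phi>) x"
    unfolding sqnorm_lumped_mass_matrix
  proof (rule sum_pos2)
    show "T \<in> \<T>" by (rule T(1))
    show "0 < weight T * (\<Sum>c\<in>vertices T. (nodal_value x c)\<^sup>2)" by (rule pos)
    show "finite \<T>" using tri by (simp add: triangulation_def)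
    show "0 \<le> weight T * (\<Sum>c\<in>vertices T. (nodal_value x c)\<^sup>2)" if "T \<in> \<T>" for T
      by (rule mult_nonneg_nonneg[OF less_imp_le[OF weight_pos[OF that]] sum_nonneg]) simp
  qed
  then have "0 < real (CARD('n) + 2) * sqnorm (mass_matrix \<T> \<phi>) x"
    using lumped_le_mass_matrix less_le_trans by blast
  then show ?thesis by (simp add: zero_less_mult_iff)
qed

end

lemma transpose_mass_matrix: "transpose (mass_matrix \<T> \<phi>) = mass_matrix \<T> \<phi>"
  by (simp add: transpose_def mass_matrix_def mult.commute)

lemma transpose_lumped_mass_matrix: "transpose (lumped_mass_matrix \<T> \<phi>) = lumped_mass_matrix \<T> \<phi>"
  by (auto simp: transpose_def lumped_mass_matrix_def vec_eq_iff)

section \<open>Quadratic forms and optimality conditions\<close>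

lemma inner_matrix_vector_left:
  fixes A :: "real^'m::finite^'n::finite"
  shows "(A *v x) \<bullet> y = x \<bullet> (transpose A *v y)"
  by (metis dot_lmul_matrix transpose_transpose transpose_matrix_vector inner_commute)

lemma inner_symmetric_matrix:
  fixes A :: "real^'n::finite^'n"
  assumes "transpose A = A"
  shows "x \<bullet> (A *v y) = y \<bullet> (A *v x)"
  by (metis assms inner_commute inner_matrix_vector_left)

lemma sqnorm_scaleR: "sqnorm A (r *\<^sub>R x) = r\<^sup>2 * sqnorm A x"
  by (simp add: sqnorm_def matrix_vector_mult_scaleR power2_eq_square)

lemma sqnorm_matrix_diff: "sqnorm (A - B) x = sqnorm A x - sqnorm B x"
  by (simp add: sqnorm_def matrix_vector_mult_diff_rdistrib inner_diff_right)

lemma sqnorm_matrix_add: "sqnorm (A + B) x = sqnorm A x + sqnorm B x"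
  by (simp add: sqnorm_def matrix_vector_mult_add_rdistrib inner_add_right)

lemma sqnorm_matrix_scaleR: "sqnorm (r *\<^sub>R A) x = r * sqnorm A x"
  by (simp add: sqnorm_def scaleR_matrix_vector_assoc[symmetric])

lemma sqnorm_congruence:
  "sqnorm (transpose B ** A ** B) x = sqnorm A (B *v x)"
  by (simp add: sqnorm_def inner_matrix_vector_left matrix_vector_mul_assoc[symmetric])

lemma sqnorm_add:
  assumes "transpose A = A"
  shows "sqnorm A (x + y) = sqnorm A x + 2 * (x \<bullet> (A *v y)) + sqnorm A y"
  using inner_symmetric_matrix[OF assms, of x y]
  by (simp add: sqnorm_def matrix_vector_right_distrib inner_add_left inner_add_right)

lemma sqnorm_line:
  assumes "transpose A = A"
  shows "sqnorm A (x + s *\<^sub>R d) = sqnorm A x + s * (2 * (d \<bullet> (A *v x))) + s\<^sup>2 * sqnorm A d"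
  using inner_symmetric_matrix[OF assms, of x d]
  by (simp add: sqnorm_add[OF assms] sqnorm_scaleR matrix_vector_mult_scaleR)

lemma sqnorm_diff_le:
  assumes "transpose A = A" and "\<And>x. 0 \<le> sqnorm A x"
  shows "sqnorm A (x - y) \<le> 2 * sqnorm A x + 2 * sqnorm A y"
  using assms(2)[of "x + y"] sqnorm_add[OF assms(1), of x y] sqnorm_add[OF assms(1), of x "- y"]
    sqnorm_scaleR[of A "-1" y] matrix_vector_mult_scaleR[of A "-1" y]
  by simp

text \<open>The difference of the two sides is half the form at \<open>y\<close>. Giving it away turns a linear proximal term
  into a difference of squared seminorms that telescopes.\<close>

lemma sqnorm_three_point:
  assumes "transpose A = A" and "\<And>x. 0 \<le> sqnorm A x"
  shows "(sqnorm A x - sqnorm A (y - x)) / 2 \<le> x \<bullet> (A *v y)"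
  using assms(2)[of y] sqnorm_add[OF assms(1), of y "- x"]
    inner_symmetric_matrix[OF assms(1), of x y] sqnorm_scaleR[of A "-1" x]
    matrix_vector_mult_scaleR[of A "-1" x]
  by simp

lemma matrix_inv_inverse:
  assumes "invertible A"
  shows "A ** matrix_inv A = mat 1" "matrix_inv A ** A = mat 1"
  using someI_ex[OF assms[unfolded invertible_def]] unfolding matrix_inv_def by auto

lemma invertible_if_sqnorm_pos:
  fixes A :: "real^'n::finite^'n"
  assumes "\<And>x. x \<noteq> 0 \<Longrightarrow> 0 < sqnorm A x"
  shows "invertible A"
proof -
  have "x = 0" if "A *v x = 0" for x
    using assms[of x] that by (auto simp: sqnorm_def)
  then show ?thesis by (auto simp: invertible_left_inverse matrix_left_invertible_ker)
qed

lemma symmetric_matrix_inv: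
  fixes A :: "real^'n::finite^'n"
  assumes "invertible A" "transpose A = A"
  shows "transpose (matrix_inv A) = matrix_inv A"
proof -
  have "transpose (matrix_inv A) ** A = mat 1"
    by (metis assms matrix_inv_inverse(1) matrix_transpose_mul transpose_mat)
  then show ?thesis
    by (metis assms(1) matrix_inv_inverse(1) matrix_mul_assoc matrix_mul_lid matrix_mul_rid)
qed

lemma sqnorm_matrix_inv:
  fixes A :: "real^'n::finite^'n"
  assumes "invertible A" "transpose A = A"
  shows "sqnorm (matrix_inv A) x = sqnorm A (matrix_inv A *v x)"
  by (metis assms sqnorm_def inner_commute matrix_inv_inverse(1) matrix_vector_mul_assoc matrix_vector_mul_lid)

lemma sqnorm_matrix_inv_pos:
  fixes A :: "real^'n::finite^'n"
  assumes "\<And>x. x \<noteq> 0 \<Longrightarrow> 0 < sqnorm A x" "transpose A = A" "x \<noteq> 0"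
  shows "0 < sqnorm (matrix_inv A) x"
proof -
  have inv: "invertible A" by (rule invertible_if_sqnorm_pos[OF assms(1)])
  have "matrix_inv A *v x \<noteq> 0"
    by (metis assms(3) inv matrix_inv_inverse(1) matrix_vector_mul_assoc matrix_vector_mul_lid matrix_vector_mult_0_right)
  then show ?thesis unfolding sqnorm_matrix_inv[OF inv assms(2)] by (rule assms(1))
qed

text \<open>The constant is the reciprocal of the minimum of \<open>q\<close> on the unit sphere.\<close>

lemma quadratic_form_coercive:
  fixes q :: "'a::euclidean_space \<Rightarrow> real"
  assumes cont: "continuous_on UNIV q" and hom: "\<And>r w. q (r *\<^sub>R w) = r\<^sup>2 * q w"
    and pos: "\<And>w. w \<noteq> 0 \<Longrightarrow> 0 < q w"
  shows "\<exists>L. \<forall>w. (norm w)\<^sup>2 \<le> L * q w"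
proof -
  have ne: "sphere (0::'a) 1 \<noteq> {}" by simp
  obtain v where v: "v \<in> sphere 0 1" "\<And>w. w \<in> sphere 0 1 \<Longrightarrow> q v \<le> q w"
    using continuous_attains_inf[OF compact_sphere ne continuous_on_subset[OF cont subset_UNIV]] by blast
  have qv: "0 < q v" using v(1) by (intro pos) auto
  have "(norm w)\<^sup>2 \<le> 1 / q v * q w" for w
  proof (cases "w = 0")
    case True then show ?thesis using hom[of 0 0] by simp
  next
    case False
    have "q w = (norm w)\<^sup>2 * q (w /\<^sub>R norm w)" using hom[of "norm w" "w /\<^sub>R norm w"] False by simp
    moreover have "q v \<le> q (w /\<^sub>R norm w)" using False by (intro v(2)) simp
    ultimately have "(norm w)\<^sup>2 * q v \<le> q w" by (simp add: mult_left_mono)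
    then show ?thesis using qv by (simp add: field_simps)
  qed
  then show ?thesis by blast
qed

text \<open>First-order condition at a minimizer of a differentiable part \<open>q\<close>, known to be a parabola along
  the segment from \<open>x\<close> to \<open>z\<close>, plus a convex part \<open>g\<close>: compare \<open>x\<close> with the points
  \<open>x + s (z - x)\<close>, divide by \<open>s\<close> and let \<open>s\<close> tend to \<open>0\<close>.\<close>

lemma minimizer_variational_inequality:
  fixes g q :: "'a::real_vector \<Rightarrow> real"
  assumes g: "convex_on C g" and x: "x \<in> C" and z: "z \<in> C"
    and min: "\<And>w. w \<in> C \<Longrightarrow> q x + g x \<le> q w + g w"
    and q: "\<And>s. q (x + s *\<^sub>R (z - x)) = q x + s * l + s\<^sup>2 * r"
  shows "g x \<le> g z + l"
proof -
  have small: "0 \<le> l + s * r + g z - g x" if s: "0 < s" "s \<le> 1" for s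
  proof -
    have eq: "x + s *\<^sub>R (z - x) = (1 - s) *\<^sub>R x + s *\<^sub>R z" by (simp add: algebra_simps)
    have "x + s *\<^sub>R (z - x) \<in> C"
      unfolding eq by (rule convexD[OF convex_on_imp_convex[OF g] x z]) (use s in auto)
    from min[OF this] have "q x + g x \<le> q x + s * l + s\<^sup>2 * r + g (x + s *\<^sub>R (z - x))"
      by (simp add: q)
    also have "g (x + s *\<^sub>R (z - x)) \<le> (1 - s) * g x + s * g z"
      unfolding eq by (rule convex_onD[OF g]) (use s x z in auto)
    finally have "0 \<le> s * (l + s * r + g z - g x)" by (simp add: algebra_simps power2_eq_square)
    then show ?thesis using s by (simp add: zero_le_mult_iff)
  qed
  have "((\<lambda>s. l + s * r + g z - g x) \<longlongrightarrow> l + 0 * r + g z - g x) (at_right 0)"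
    by (intro tendsto_intros)
  moreover have "\<forall>\<^sub>F s in at_right 0. 0 \<le> l + s * r + g z - g x"
    unfolding eventually_at_right_field by (intro exI[of _ 1]) (use small in auto)
  ultimately have "0 \<le> l + 0 * r + g z - g x"
    by (rule tendsto_lowerbound) simp
  then show ?thesis by simp
qed

lemma support_fun_real:
  assumes "bounded S" "S \<noteq> {}"
  shows "support_fun S \<xi> = ereal (real_of_ereal (support_fun S \<xi>))"
proof -
  obtain B where B: "\<And>u. u \<in> S \<Longrightarrow> norm u \<le> B" using assms(1) by (auto simp: bounded_iff)
  obtain u0 where u0: "u0 \<in> S" using assms(2) by blast
  have "support_fun S \<xi> \<le> ereal (norm \<xi> * B)" unfolding support_fun_def
  proof (rule SUP_least)
    fix u assume "u \<in> S"
    then show "ereal (\<xi> \<bullet> u) \<le> ereal (norm \<xi> * B)"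
      using norm_cauchy_schwarz[of \<xi> u] mult_left_mono[OF B norm_ge_zero[of \<xi>]] by force
  qed
  moreover have "ereal (\<xi> \<bullet> u0) \<le> support_fun S \<xi>"
    unfolding support_fun_def by (rule SUP_upper[OF u0])
  ultimately have "\<bar>support_fun S \<xi>\<bar> \<noteq> \<infinity>" by auto
  then show ?thesis by (simp add: ereal_real')
qed

lemma convex_on_support_fun:
  fixes S :: "(real^'n::finite) set" and A :: "real^'m::finite^'n"
  assumes "bounded S" "S \<noteq> {}"
  shows "convex_on UNIV (\<lambda>x. real_of_ereal (support_fun S (A *v x)))"
proof (rule convex_onI)
  let ?\<sigma> = "\<lambda>\<xi>. real_of_ereal (support_fun S \<xi>)"
  fix t :: real and x y assume t: "0 < t" "t < 1"
  have le: "\<xi> \<bullet> u \<le> ?\<sigma> \<xi>" if "u \<in> S" for u \<xi>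
  proof -
    have "ereal (\<xi> \<bullet> u) \<le> support_fun S \<xi>"
      unfolding support_fun_def by (rule SUP_upper[OF that])
    then show ?thesis using support_fun_real[OF assms, of \<xi>] by (metis ereal_less_eq(3))
  qed
  have "support_fun S (A *v ((1 - t) *\<^sub>R x + t *\<^sub>R y)) \<le> ereal ((1 - t) * ?\<sigma> (A *v x) + t * ?\<sigma> (A *v y))"
    unfolding support_fun_def[of _ "A *v ((1 - t) *\<^sub>R x + t *\<^sub>R y)"]
  proof (rule SUP_least)
    fix u assume u: "u \<in> S"
    show "ereal ((A *v ((1 - t) *\<^sub>R x + t *\<^sub>R y)) \<bullet> u) \<le> ereal ((1 - t) * ?\<sigma> (A *v x) + t * ?\<sigma> (A *v y))"
    proof -
      have "(1 - t) * ((A *v x) \<bullet> u) + t * ((A *v y) \<bullet> u)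
          \<le> (1 - t) * ?\<sigma> (A *v x) + t * ?\<sigma> (A *v y)"
        by (intro add_mono mult_left_mono le u) (use t in auto)
      then show ?thesis
        by (simp add: matrix_vector_right_distrib matrix_vector_mult_scaleR inner_add_left)
    qed
  qed
  then show "?\<sigma> (A *v ((1 - t) *\<^sub>R x + t *\<^sub>R y)) \<le> (1 - t) * ?\<sigma> (A *v x) + t * ?\<sigma> (A *v y)"
    by (metis support_fun_real[OF assms] ereal_less_eq(3))
qed simp

lemma box_set_interval: "box_set a b = cbox (\<chi> i. a) (\<chi> i. b)"
  by (auto simp: box_set_def mem_box_cart)

section \<open>Accelerated descent with summable errors\<close>

text \<open>Starting the recursion at \<open>t 0 = 0\<close> gives \<open>t 1 = 1\<close> and lets the first step follow the same
  formulas as all later ones.\<close>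

lemma nesterov_parameters:
  fixes t :: "nat \<Rightarrow> real"
  assumes t0: "t 0 = 0" and rec: "\<And>k. t (Suc k) = (1 + sqrt (1 + 4 * (t k)\<^sup>2)) / 2"
  shows "(t (Suc k))\<^sup>2 - t (Suc k) = (t k)\<^sup>2"
    and "1 \<le> t (Suc k)" and "t k \<le> real k"
    and "real (Suc k) + 1 \<le> 2 * t (Suc k)"
proof -
  have id: "(t (Suc k))\<^sup>2 - t (Suc k) = (t k)\<^sup>2" for k
  proof -
    have "(sqrt (1 + 4 * (t k)\<^sup>2))\<^sup>2 = 1 + 4 * (t k)\<^sup>2" by simp
    moreover have "sqrt (1 + 4 * (t k)\<^sup>2) = 2 * t (Suc k) - 1" using rec[of k] by simp
    ultimately have "(2 * t (Suc k) - 1)\<^sup>2 = 1 + 4 * (t k)\<^sup>2" by simp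
    then show ?thesis by (simp add: power2_eq_square algebra_simps)
  qed
  show "(t (Suc k))\<^sup>2 - t (Suc k) = (t k)\<^sup>2" by (rule id)
  have ge1: "1 \<le> t (Suc k)" for k
  proof -
    have "1 \<le> sqrt (1 + 4 * (t k)\<^sup>2)" by simp
    then show ?thesis unfolding rec by simp
  qed
  show "1 \<le> t (Suc k)" by (rule ge1)
  have nn: "0 \<le> t k" for k
    by (cases k) (use t0 ge1[of "k - 1"] in auto)
  show "t k \<le> real k"
  proof (induction k)
    case (Suc k)
    have "sqrt (1 + 4 * (t k)\<^sup>2) \<le> 1 + 2 * t k"
      by (rule real_le_lsqrt) (use nn[of k] in \<open>auto simp: power2_eq_square algebra_simps\<close>)
    then have "t (Suc k) \<le> 1 + t k" unfolding rec by simp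
    with Suc show ?case by simp
  qed (simp add: t0)
  show "real (Suc k) + 1 \<le> 2 * t (Suc k)"
  proof (induction k)
    case 0 show ?case using ge1[of 0] by simp
  next
    case (Suc k)
    have "2 * t (Suc k) \<le> sqrt (1 + 4 * (t (Suc k))\<^sup>2)"
      by (rule real_le_rsqrt) (auto simp: power2_eq_square)
    then have "2 * t (Suc k) + 1 \<le> 2 * t (Suc (Suc k))" unfolding rec[of "Suc k"] by simp
    with Suc show ?case by simp
  qed
qed

text \<open>A difference \<open>A (Suc k) - A k\<close> factors into the difference and the sum of the square roots, so the
  hypothesis says that the square roots grow by at most \<open>c k\<close>.\<close>

lemma sqrt_increments_summable_imp_bounded:
  fixes A c :: "nat \<Rightarrow> real"
  assumes A: "\<And>k. 0 \<le> A k" and c: "\<And>k. 0 \<le> c k" "summable c"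
    and step: "\<And>k. A (Suc k) \<le> A k + c k * (sqrt (A (Suc k)) + sqrt (A k))"
  shows "\<exists>B. \<forall>k. A k \<le> B"
proof -
  have inc: "sqrt (A (Suc k)) \<le> sqrt (A k) + c k" for k
  proof (rule ccontr)
    assume "\<not> ?thesis"
    then have gt: "c k < sqrt (A (Suc k)) - sqrt (A k)" by simp
    then have "0 < sqrt (A (Suc k)) + sqrt (A k)"
      using c(1)[of k] real_sqrt_ge_zero[OF A[of k]] by linarith
    then have "c k * (sqrt (A (Suc k)) + sqrt (A k))
        < (sqrt (A (Suc k)) - sqrt (A k)) * (sqrt (A (Suc k)) + sqrt (A k))"
      using gt by (rule mult_strict_right_mono[rotated])
    also have "\<dots> = A (Suc k) - A k"
      using A[of k] A[of "Suc k"] by (simp add: algebra_simps)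
    finally show False using step[of k] by simp
  qed
  have "sqrt (A k) \<le> sqrt (A 0) + sum c {..<k}" for k
  proof (induction k)
    case (Suc k) then show ?case using inc[of k] by simp
  qed simp
  moreover have "sum c {..<k} \<le> suminf c" for k
    by (rule sum_le_suminf) (use c in auto)
  ultimately have b: "sqrt (A k) \<le> sqrt (A 0) + suminf c" for k
    by (meson add_left_mono order_trans)
  have "A k \<le> (sqrt (A 0) + suminf c)\<^sup>2" for k
    using power_mono[OF b[of k] real_sqrt_ge_zero[OF A], of 2] A[of k] by simp
  then show ?thesis by blast
qed

text \<open>The three-point inequality is used at \<open>w = (1 - 1/t) x\<^sub>k + (1/t) z\<close>, scaled by \<open>t\<^sup>2\<close>, where \<open>t\<close> is
  the next parameter; by \<open>t\<^sup>2 - t = t\<^sub>k\<^sup>2\<close> it becomes a descent inequality for the energy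
  \<open>A k = 2 t\<^sub>k\<^sup>2 (F (x k) - F z) + S (u k)\<close>, up to the pairing of the error with \<open>u\<close>.
  The seminorm \<open>S\<close> may be degenerate. Growth bounds
  \<open>t\<^sub>k\<^sup>2 Q (x k - z)\<close> by the energy, hence bounds \<open>Q (u (Suc k))\<close> by two consecutive energies, and
  \<open>S + Q\<close> dominates the squared norm.\<close>

theorem inexact_accelerated_gradient_rate:
  fixes x y \<delta> :: "nat \<Rightarrow> 'a::real_inner" and z :: 'a and t e :: "nat \<Rightarrow> real"
    and F S Q :: "'a \<Rightarrow> real"
  assumes t: "t 0 = 0" "\<And>k. t (Suc k) = (1 + sqrt (1 + 4 * (t k)\<^sup>2)) / 2"
    and y: "\<And>k. y (Suc k) = x k + ((t k - 1) / t (Suc k)) *\<^sub>R (x k - x (k - 1))"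
    and conv: "convex_on C F" and xC: "\<And>k. x k \<in> C" and zC: "z \<in> C"
    and step: "\<And>k w. w \<in> C \<Longrightarrow> F (x (Suc k)) + \<delta> k \<bullet> (w - x (Suc k))
          + (S (x (Suc k) - w) - S (y (Suc k) - w)) / 2 \<le> F w"
    and err: "\<And>k. norm (\<delta> k) \<le> e k" and e_sum: "summable (\<lambda>k. real (Suc k) * e k)"
    and growth: "\<And>w. w \<in> C \<Longrightarrow> F z + Q (w - z) / 2 \<le> F w"
    and S0: "\<And>w. 0 \<le> S w" and Sh: "\<And>r w. S (r *\<^sub>R w) = r\<^sup>2 * S w"
    and Q0: "\<And>w. 0 \<le> Q w" and Qh: "\<And>r w. Q (r *\<^sub>R w) = r\<^sup>2 * Q w"
    and Qd: "\<And>v w. Q (v - w) \<le> 2 * Q v + 2 * Q w"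
    and coercive: "\<And>w. (norm w)\<^sup>2 \<le> L * (S w + Q w)"
  shows "\<exists>c. \<forall>k\<ge>1. F (x k) - F z \<le> c / (real k + 1)\<^sup>2"
proof -
  note tid = nesterov_parameters(1)[OF t] and t1 = nesterov_parameters(2)[OF t]
    and tk = nesterov_parameters(3)[OF t] and tlow = nesterov_parameters(4)[OF t]
  have gap: "0 \<le> F w - F z" if "w \<in> C" for w
    using growth[OF that] Q0[of "w - z"] by linarith
  \<comment> \<open>For \<open>k = 0\<close> the index \<open>k - 1\<close> is again \<open>0\<close>, so that \<open>u 0 = x 0 - z\<close>.\<close>
  define u where "u k = t k *\<^sub>R x k - (t k - 1) *\<^sub>R x (k - 1) - z" for k
  define A where "A k = 2 * (t k)\<^sup>2 * (F (x k) - F z) + S (u k)" for k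
  have A0: "0 \<le> A k" for k
    unfolding A_def using gap[OF xC[of k]] S0[of "u k"] by simp
  have e0: "0 \<le> e k" for k using err[of k] norm_ge_zero order_trans by blast
  define L' where "L' = max L 0"
  have L': "0 \<le> L'" "(norm w)\<^sup>2 \<le> L' * (S w + Q w)" for w
  proof -
    show "0 \<le> L'" by (simp add: L'_def)
    have "L * (S w + Q w) \<le> L' * (S w + Q w)"
      by (rule mult_right_mono) (use S0[of w] Q0[of w] in \<open>auto simp: L'_def\<close>)
    then show "(norm w)\<^sup>2 \<le> L' * (S w + Q w)" using coercive[of w] by linarith
  qed
  have SA: "S (u k) \<le> A k" for k
    unfolding A_def using gap[OF xC[of k]] by simp
  have QA: "(t k)\<^sup>2 * Q (x k - z) \<le> A k" for k
  proof -
    have "(t k)\<^sup>2 * Q (x k - z) \<le> (t k)\<^sup>2 * (2 * (F (x k) - F z))"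
      by (rule mult_left_mono) (use growth[OF xC[of k]] in auto)
    then show ?thesis unfolding A_def using S0[of "u k"] by argo
  qed
  have ubound: "norm (u (Suc k)) \<le> sqrt (3 * L') * (sqrt (A (Suc k)) + sqrt (A k))" for k
  proof -
    let ?t = "t (Suc k)"
    have u: "u (Suc k) = ?t *\<^sub>R (x (Suc k) - z) - (?t - 1) *\<^sub>R (x k - z)"
      by (simp add: u_def algebra_simps)
    have "Q (u (Suc k)) \<le> 2 * (?t\<^sup>2 * Q (x (Suc k) - z)) + 2 * ((?t - 1)\<^sup>2 * Q (x k - z))"
      unfolding u using Qd[of "?t *\<^sub>R (x (Suc k) - z)" "(?t - 1) *\<^sub>R (x k - z)"] by (simp add: Qh)
    moreover have "(?t - 1)\<^sup>2 * Q (x k - z) \<le> (t k)\<^sup>2 * Q (x k - z)"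
    proof (rule mult_right_mono)
      show "(?t - 1)\<^sup>2 \<le> (t k)\<^sup>2"
        using tid[of k] t1[of k] by (simp add: power2_eq_square algebra_simps)
    qed (rule Q0)
    ultimately have "S (u (Suc k)) + Q (u (Suc k)) \<le> 3 * (A (Suc k) + A k)"
      using QA[of "Suc k"] QA[of k] SA[of "Suc k"] A0[of k] by argo
    from mult_left_mono[OF this L'(1)] L'(2)[of "u (Suc k)"]
    have "(norm (u (Suc k)))\<^sup>2 \<le> 3 * L' * (A (Suc k) + A k)" by argo
    then have "norm (u (Suc k)) \<le> sqrt (3 * L' * (A (Suc k) + A k))"
      by (rule real_le_rsqrt)
    also have "\<dots> = sqrt (3 * L') * sqrt (A (Suc k) + A k)" by (rule real_sqrt_mult)
    also have "\<dots> \<le> sqrt (3 * L') * (sqrt (A (Suc k)) + sqrt (A k))"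
      by (rule mult_left_mono[OF sqrt_add_le_add_sqrt]) (use A0 L'(1) in auto)
    finally show ?thesis .
  qed
  define c where "c k = 2 * sqrt (3 * L') * (real (Suc k) * e k)" for k
  have c0: "0 \<le> c k" for k using e0[of k] L'(1) by (simp add: c_def)
  have c_sum: "summable c" unfolding c_def by (rule summable_mult[OF e_sum])
  have descent: "A (Suc k) \<le> A k + c k * (sqrt (A (Suc k)) + sqrt (A k))" for k
  proof -
    let ?t = "t (Suc k)"
    have tpos: "0 < ?t" using t1[of k] by simp
    define w where "w = (1 - 1 / ?t) *\<^sub>R x k + (1 / ?t) *\<^sub>R z"
    have th: "0 \<le> 1 / ?t" "1 / ?t \<le> 1" using t1[of k] by auto
    have wC: "w \<in> C" unfolding w_def
      by (rule convexD[OF convex_on_imp_convex[OF conv]]) (use th xC zC in auto)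
    have Fw: "F w \<le> (1 - 1 / ?t) * F (x k) + (1 / ?t) * F z" unfolding w_def
      by (rule convex_onD[OF conv th xC zC])
    have tw: "?t *\<^sub>R w = (?t - 1) *\<^sub>R x k + z"
      using tpos by (simp add: w_def scaleR_add_right right_diff_distrib)
    have ux: "?t *\<^sub>R (x (Suc k) - w) = u (Suc k)"
      by (simp add: scaleR_diff_right tw u_def)
    have uy: "?t *\<^sub>R (y (Suc k) - w) = u k"
    proof -
      have "?t *\<^sub>R y (Suc k) = ?t *\<^sub>R x k + (t k - 1) *\<^sub>R (x k - x (k - 1))"
        using tpos by (simp add: y scaleR_add_right)
      then show ?thesis by (simp add: scaleR_diff_right tw u_def algebra_simps)
    qed
    have "?t\<^sup>2 * (F (x (Suc k)) + \<delta> k \<bullet> (w - x (Suc k)) + (S (x (Suc k) - w) - S (y (Suc k) - w)) / 2)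
        \<le> ?t\<^sup>2 * ((1 - 1 / ?t) * F (x k) + (1 / ?t) * F z)"
      by (rule mult_left_mono) (use step[OF wC, of k] Fw in auto)
    also have "\<dots> = (?t\<^sup>2 - ?t) * F (x k) + ?t * F z"
      using tpos by (simp add: field_simps power2_eq_square)
    also have "\<dots> = (t k)\<^sup>2 * (F (x k) - F z) + ?t\<^sup>2 * F z"
      using tid[of k] by (simp add: algebra_simps)
    also have "?t\<^sup>2 * (F (x (Suc k)) + \<delta> k \<bullet> (w - x (Suc k)) + (S (x (Suc k) - w) - S (y (Suc k) - w)) / 2)
       = ?t\<^sup>2 * F (x (Suc k)) - ?t * (\<delta> k \<bullet> u (Suc k)) + (S (u (Suc k)) - S (u k)) / 2"
    proof -
      have "S (u (Suc k)) = ?t\<^sup>2 * S (x (Suc k) - w)" "S (u k) = ?t\<^sup>2 * S (y (Suc k) - w)"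
        by (simp_all only: ux[symmetric] uy[symmetric] Sh)
      moreover have "?t * (\<delta> k \<bullet> u (Suc k)) = - (?t\<^sup>2 * (\<delta> k \<bullet> (w - x (Suc k))))"
        by (simp add: ux[symmetric] inner_diff_right power2_eq_square algebra_simps)
      ultimately show ?thesis by argo
    qed
    finally have "A (Suc k) \<le> A k + 2 * (?t * (\<delta> k \<bullet> u (Suc k)))"
      unfolding A_def by argo
    also have "?t * (\<delta> k \<bullet> u (Suc k)) \<le> real (Suc k) * (e k * norm (u (Suc k)))"
    proof -
      have "\<delta> k \<bullet> u (Suc k) \<le> e k * norm (u (Suc k))"
        using norm_cauchy_schwarz[of "\<delta> k" "u (Suc k)"] mult_right_mono[OF err[of k] norm_ge_zero]
        by (meson order_trans)
      then have "?t * (\<delta> k \<bullet> u (Suc k)) \<le> ?t * (e k * norm (u (Suc k)))"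
        using tpos by simp
      also have "\<dots> \<le> real (Suc k) * (e k * norm (u (Suc k)))"
        by (rule mult_right_mono[OF tk]) (simp add: e0)
      finally show ?thesis .
    qed
    also have "real (Suc k) * (e k * norm (u (Suc k)))
        \<le> real (Suc k) * (e k * (sqrt (3 * L') * (sqrt (A (Suc k)) + sqrt (A k))))"
      by (intro mult_left_mono ubound e0) simp
    finally show ?thesis by (simp add: c_def algebra_simps)
  qed
  obtain B where B: "\<And>k. A k \<le> B"
    using sqrt_increments_summable_imp_bounded[OF A0 c0 c_sum descent] by blast
  have "F (x k) - F z \<le> 2 * B / (real k + 1)\<^sup>2" if k: "k \<ge> 1" for k
  proof -
    obtain j where j: "k = Suc j" using k by (cases k) auto
    have "(real k + 1)\<^sup>2 \<le> (2 * t k)\<^sup>2"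
      unfolding j by (rule power_mono[OF tlow]) simp
    then have "(real k + 1)\<^sup>2 * (F (x k) - F z) \<le> (2 * t k)\<^sup>2 * (F (x k) - F z)"
      by (rule mult_right_mono) (rule gap[OF xC])
    also have "\<dots> = 2 * (2 * (t k)\<^sup>2 * (F (x k) - F z))" by (simp add: power2_eq_square)
    also have "\<dots> \<le> 2 * B" using B[of k] S0[of "u k"] unfolding A_def by linarith
    finally have "(F (x k) - F z) * (real k + 1)\<^sup>2 \<le> 2 * B" by (simp add: mult.commute)
    moreover have "0 < (real k + 1)\<^sup>2" by simp
    ultimately show ?thesis by (simp add: pos_le_divide_eq)
  qed
  then show ?thesis by blast
qed

section \<open>The block step for the discretized dual problem\<close>

text \<open>The discretized problem with the finite element matrices replaced by what the analysis of the
  algorithm uses: the comparison of \<open>M\<close> and \<open>W\<close> as quadratic forms.\<close>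

locale lumped_mass_dual =
  fixes \<alpha> \<beta> a b cn :: real and K M W :: "real^'N::finite^'N" and yd yr :: "real^'N"
  assumes \<alpha>_pos: "0 < \<alpha>" and \<beta>_nonneg: "0 \<le> \<beta>" and a_nonpos: "a \<le> 0" and b_nonneg: "0 \<le> b"
    and M_sym: "transpose M = M" and W_sym: "transpose W = W"
    and M_pos: "x \<noteq> 0 \<Longrightarrow> 0 < sqnorm M x"
    and M_le_W: "sqnorm M x \<le> sqnorm W x" and W_le_M: "sqnorm W x \<le> cn * sqnorm M x"
begin

abbreviation "Mi \<equiv> matrix_inv M"
text \<open>\<open>R\<close> is the Hessian of the tracking term in \<open>p\<close>, and \<open>H\<close> is the Hessian of the smooth part of the
  objective in \<open>p\<close>. The transpose makes this true for nonsymmetric \<open>K\<close> too.\<close>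

definition "R = transpose K ** Mi ** K"
definition "H = R + (1/\<alpha>) *\<^sub>R M"
abbreviation "G \<equiv> matrix_inv H"

definition smooth :: "'N triple \<Rightarrow> real" where
  "smooth = (\<lambda>(mu, lam, p). 1/2 * sqnorm Mi (K *v p - M *v yd)
     + 1/(2*\<alpha>) * sqnorm M (lam + mu - p) + (M *v yr) \<bullet> p)"

definition nonsmooth :: "real^'N \<Rightarrow> real" where
  "nonsmooth m = real_of_ereal (support_fun (box_set a b) (M *v m))"

definition objective :: "'N triple \<Rightarrow> real" where
  "objective = (\<lambda>(mu, lam, p). smooth (mu, lam, p) + nonsmooth mu - 1/2 * sqnorm M yd)"

definition feasible :: "'N triple set" where
  "feasible = UNIV \<times> box_set (-\<beta>) \<beta> \<times> UNIV"

text \<open>For symmetric \<open>K\<close> this is the quadratic form of \<open>\<S>\<close>: since \<open>M + \<alpha> R = \<alpha> H\<close>, the matrix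
  \<open>M (M + \<alpha> R)\<inverse> M / \<alpha>\<close> in \<open>\<D>\<^sub>2\<close> has the form \<open>\<lambda> \<mapsto> \<alpha>\<^sup>-\<^sup>2 (M \<lambda>) \<bullet> G (M \<lambda>)\<close>, and the last two terms
  come from \<open>\<Q>\<^sub>2\<^sub>2\<close>.\<close>

definition metric_form :: "'N triple \<Rightarrow> real" where
  "metric_form = (\<lambda>(mu, lam, p). sqnorm (D1 \<alpha> cn M W) mu + 1/\<alpha> * sqnorm (W - M) lam
     + (1/\<alpha>)\<^sup>2 * sqnorm G (M *v lam) + 1/\<alpha> * sqnorm M (lam - p) + sqnorm R p)"

text \<open>The quadratic form of the Hessian of the smooth part of the objective; see \<open>smooth_add\<close>.\<close>

definition hessian_form :: "'N triple \<Rightarrow> real" where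
  "hessian_form = (\<lambda>(mu, lam, p). 1/\<alpha> * sqnorm M (lam + mu - p) + sqnorm R p)"

lemma M_nonneg: "0 \<le> sqnorm M x"
  using M_pos[of x] by (cases "x = 0") (auto simp: sqnorm_def)

lemma W_pos: "x \<noteq> 0 \<Longrightarrow> 0 < sqnorm W x"
  using M_pos M_le_W by (rule less_le_trans)

lemma M_inv: "invertible M" and W_inv: "invertible W"
  by (rule invertible_if_sqnorm_pos, rule M_pos, assumption,
      rule invertible_if_sqnorm_pos, rule W_pos)

lemma Mi_sym: "transpose Mi = Mi"
  by (rule symmetric_matrix_inv[OF M_inv M_sym])

lemma Mi_nonneg: "0 \<le> sqnorm Mi x"
  unfolding sqnorm_matrix_inv[OF M_inv M_sym] by (rule M_nonneg)

lemma sqnorm_R: "sqnorm R x = sqnorm Mi (K *v x)"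
  unfolding R_def by (rule sqnorm_congruence)

lemma R_nonneg: "0 \<le> sqnorm R x"
  unfolding sqnorm_R by (rule Mi_nonneg)

lemma R_sym: "transpose R = R"
  by (simp add: R_def matrix_transpose_mul matrix_mul_assoc Mi_sym)

lemma transpose_scaleR_add: "transpose (A + r *\<^sub>R B) = transpose A + r *\<^sub>R transpose B" for A B :: "real^'N^'N"
  by (simp add: transpose_def vec_eq_iff)

lemma transpose_scaleR_diff: "transpose (r *\<^sub>R (s *\<^sub>R A - B)) = r *\<^sub>R (s *\<^sub>R transpose A - transpose B)" for A B :: "real^'N^'N"
  by (simp add: transpose_def vec_eq_iff)

lemma H_sym: "transpose H = H"
  by (simp add: H_def transpose_scaleR_add R_sym M_sym)

lemma H_pos: "x \<noteq> 0 \<Longrightarrow> 0 < sqnorm H x"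
  unfolding H_def sqnorm_matrix_add sqnorm_matrix_scaleR
  using R_nonneg[of x] M_pos[of x] \<alpha>_pos by (intro add_nonneg_pos) auto

lemma H_inv: "invertible H"
  by (rule invertible_if_sqnorm_pos[OF H_pos])

lemma G_sym: "transpose G = G"
  by (rule symmetric_matrix_inv[OF H_inv H_sym])

lemma G_pos: "x \<noteq> 0 \<Longrightarrow> 0 < sqnorm G x"
  by (rule sqnorm_matrix_inv_pos[OF H_pos H_sym])

lemma G_nonneg: "0 \<le> sqnorm G x"
  using G_pos[of x] by (cases "x = 0") (auto simp: sqnorm_def)

lemma W_minus_M_sym: "transpose (W - M) = W - M"
  using transpose_scaleR_diff[of 1 1 W M] by (simp add: W_sym M_sym)

lemma W_minus_M_nonneg: "0 \<le> sqnorm (W - M) x"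
  using M_le_W[of x] by (simp add: sqnorm_matrix_diff)

lemma D1_sym: "transpose (D1 \<alpha> cn M W) = D1 \<alpha> cn M W"
  by (simp add: D1_def transpose_scaleR_diff matrix_transpose_mul matrix_mul_assoc M_sym
      symmetric_matrix_inv[OF W_inv W_sym])

text \<open>With \<open>w = W\<inverse> M x\<close> the claim is \<open>x \<bullet> M x \<le> cn (w \<bullet> M x)\<close>. Expand the nonnegative form of \<open>W\<close> at
  \<open>x - cn w\<close> and use \<open>W \<le> cn M\<close>.\<close>

lemma D1_nonneg: "0 \<le> sqnorm (D1 \<alpha> cn M W) x"
proof -
  define w where "w = matrix_inv W *v (M *v x)"
  have Ww: "W *v w = M *v x"
    unfolding w_def by (metis matrix_vector_mul_assoc matrix_inv_inverse(1)[OF W_inv] matrix_vector_mul_lid)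
  have "0 \<le> sqnorm W (x + (- cn) *\<^sub>R w)" using M_nonneg M_le_W order_trans by blast
  also have "\<dots> = sqnorm W x - cn * (2 * (w \<bullet> (W *v x))) + cn\<^sup>2 * (w \<bullet> (M *v x))"
    unfolding sqnorm_line[OF W_sym] by (simp add: sqnorm_def[of W w] Ww)
  also have "w \<bullet> (W *v x) = x \<bullet> (M *v x)"
    using inner_symmetric_matrix[OF W_sym, of w x] Ww by simp
  finally have ineq: "0 \<le> cn * (cn * (w \<bullet> (M *v x)) - sqnorm M x) + (sqnorm W x - cn * sqnorm M x)"
    by (simp add: sqnorm_def algebra_simps power2_eq_square)
  have D1: "sqnorm (D1 \<alpha> cn M W) x = 1/\<alpha> * (cn * (w \<bullet> (M *v x)) - sqnorm M x)"
  proof -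
    have "x \<bullet> (M *v w) = w \<bullet> (M *v x)" by (rule inner_symmetric_matrix[OF M_sym])
    then show ?thesis
      by (simp add: D1_def sqnorm_def w_def scaleR_matrix_vector_assoc[symmetric] matrix_vector_mult_diff_rdistrib
          inner_diff_right matrix_vector_mul_assoc[symmetric])
  qed
  show ?thesis
  proof (cases "x = 0")
    case False
    then have "0 < cn * sqnorm M x" using W_pos W_le_M less_le_trans by blast
    then have "0 < cn" using M_pos[OF False] by (simp add: zero_less_mult_iff)
    moreover have "0 \<le> cn * (cn * (w \<bullet> (M *v x)) - sqnorm M x)" using ineq W_le_M[of x] by linarith
    ultimately show ?thesis unfolding D1 using \<alpha>_pos by (simp add: zero_le_mult_iff)
  qed (simp add: sqnorm_def)
qed

lemma metric_form_nonneg: "0 \<le> metric_form z"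
  unfolding metric_form_def using \<alpha>_pos
  by (auto split: prod.split intro!: add_nonneg_nonneg mult_nonneg_nonneg divide_nonneg_nonneg
     D1_nonneg W_minus_M_nonneg G_nonneg M_nonneg R_nonneg)

lemma metric_form_scaleR: "metric_form (r *\<^sub>R z) = r\<^sup>2 * metric_form z"
  by (cases z) (simp add: metric_form_def sqnorm_scaleR matrix_vector_mult_scaleR
     flip: scaleR_diff_right, simp add: algebra_simps)

lemma hessian_form_nonneg: "0 \<le> hessian_form z"
  unfolding hessian_form_def using \<alpha>_pos
  by (auto split: prod.split intro!: add_nonneg_nonneg mult_nonneg_nonneg divide_nonneg_nonneg M_nonneg R_nonneg)

lemma hessian_form_scaleR: "hessian_form (r *\<^sub>R z) = r\<^sup>2 * hessian_form z"
  by (cases z) (simp add: hessian_form_def sqnorm_scaleR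
     flip: scaleR_diff_right scaleR_add_right, simp add: algebra_simps)

lemma hessian_form_diff_le: "hessian_form (v - w) \<le> 2 * hessian_form v + 2 * hessian_form w"
proof -
  obtain m l q m' l' q' where vw: "v = (m, l, q)" "w = (m', l', q')" by (metis surj_pair)
  have "sqnorm M ((l + m - q) - (l' + m' - q')) \<le> 2 * sqnorm M (l + m - q) + 2 * sqnorm M (l' + m' - q')"
    by (rule sqnorm_diff_le[OF M_sym M_nonneg])
  then have "1/\<alpha> * sqnorm M ((l + m - q) - (l' + m' - q'))
       \<le> 1/\<alpha> * (2 * sqnorm M (l + m - q) + 2 * sqnorm M (l' + m' - q'))"
    by (rule mult_left_mono) (use \<alpha>_pos in auto)
  moreover have "sqnorm R (q - q') \<le> 2 * sqnorm R q + 2 * sqnorm R q'"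
    by (rule sqnorm_diff_le[OF R_sym R_nonneg])
  moreover have "(l - l') + (m - m') - (q - q') = (l + m - q) - (l' + m' - q')" by simp
  ultimately show ?thesis unfolding vw hessian_form_def by (simp add: algebra_simps)
qed

text \<open>Neither form need be definite: \<open>\<D>\<^sub>1\<close> may be singular, and the Hessian form ignores directions with
  \<open>\<lambda> + \<mu> = 0\<close>, \<open>p = 0\<close>. If both vanish, the metric form gives \<open>\<lambda> = p = 0\<close>, and then the Hessian
  form gives \<open>\<mu> = 0\<close>.\<close>

lemma forms_coercive: "\<exists>L. \<forall>w. (norm w)\<^sup>2 \<le> L * (metric_form w + hessian_form w)"
proof (rule quadratic_form_coercive)
  show "continuous_on UNIV (\<lambda>w. metric_form w + hessian_form w)"
    unfolding metric_form_def hessian_form_def sqnorm_def case_prod_beta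
    by (intro continuous_intros bounded_linear.continuous_on[OF matrix_vector_mul_bounded_linear])
  show "metric_form (r *\<^sub>R w) + hessian_form (r *\<^sub>R w) = r\<^sup>2 * (metric_form w + hessian_form w)" for r w
    by (simp add: metric_form_scaleR hessian_form_scaleR distrib_left)
  show "0 < metric_form w + hessian_form w" if "w \<noteq> 0" for w
  proof (rule ccontr)
    obtain m l q where w: "w = (m, l, q)" by (metis surj_pair)
    assume "\<not> ?thesis"
    then have le: "sqnorm (D1 \<alpha> cn M W) m + 1/\<alpha> * sqnorm (W - M) l
       + (1/\<alpha>)\<^sup>2 * sqnorm G (M *v l) + 1/\<alpha> * sqnorm M (l - q) + sqnorm R q
       + (1/\<alpha> * sqnorm M (l + m - q) + sqnorm R q) \<le> 0"
      by (simp add: w metric_form_def hessian_form_def)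
    have nn: "0 \<le> 1/\<alpha> * sqnorm (W - M) l" "0 \<le> (1/\<alpha>)\<^sup>2 * sqnorm G (M *v l)"
       "0 \<le> 1/\<alpha> * sqnorm M (l - q)" "0 \<le> 1/\<alpha> * sqnorm M (l + m - q)"
      using \<alpha>_pos W_minus_M_nonneg G_nonneg M_nonneg by simp_all
    note zero = le nn D1_nonneg[of m] R_nonneg[of q]
    have "1/\<alpha> * sqnorm M (l - q) \<le> 0" using zero by linarith
    then have lq: "l - q = 0" using M_pos[of "l - q"] \<alpha>_pos by (smt (verit) divide_pos_pos mult_pos_pos)
    have "1/\<alpha> * sqnorm M (l + m - q) \<le> 0" using zero by linarith
    then have lmq: "l + m - q = 0" using M_pos[of "l + m - q"] \<alpha>_pos by (smt (verit) divide_pos_pos mult_pos_pos)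
    have "(1/\<alpha>)\<^sup>2 * sqnorm G (M *v l) \<le> 0" using zero by linarith
    then have "M *v l = 0" using G_pos[of "M *v l"] \<alpha>_pos by (smt (verit) divide_pos_pos mult_pos_pos zero_less_power)
    then have "l = 0" using M_pos[of l] by (auto simp: sqnorm_def)
    with lq lmq have "w = 0" by (simp add: w zero_prod_def)
    with that show False by simp
  qed
qed


lemma smooth_add:
  "smooth ((mu, lam, p) + (m, l, q)) = smooth (mu, lam, p)
     + (1/\<alpha> * ((l + m - q) \<bullet> (M *v (lam + mu - p)))
        + (K *v q) \<bullet> (Mi *v (K *v p - M *v yd)) + (M *v yr) \<bullet> q)
     + hessian_form (m, l, q) / 2"
proof -
  have "(lam + l) + (mu + m) - (p + q) = (lam + mu - p) + (l + m - q)" by simp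
  then have 1: "sqnorm M ((lam + l) + (mu + m) - (p + q)) = sqnorm M (lam + mu - p)
      + 2 * ((l + m - q) \<bullet> (M *v (lam + mu - p))) + sqnorm M (l + m - q)"
    by (metis sqnorm_add[OF M_sym] inner_symmetric_matrix[OF M_sym])
  have "K *v (p + q) - M *v yd = (K *v p - M *v yd) + K *v q"
    by (simp add: matrix_vector_right_distrib)
  then have 2: "sqnorm Mi (K *v (p + q) - M *v yd) = sqnorm Mi (K *v p - M *v yd)
      + 2 * ((K *v q) \<bullet> (Mi *v (K *v p - M *v yd))) + sqnorm Mi (K *v q)"
    by (metis sqnorm_add[OF Mi_sym] inner_symmetric_matrix[OF Mi_sym])
  show ?thesis
    by (simp add: smooth_def hessian_form_def 1 2 sqnorm_R inner_add_right distrib_left add_divide_distrib)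
qed

lemma box_bounded: "bounded (box_set a b :: (real^'N) set)"
  and box_nonempty: "(box_set a b :: (real^'N) set) \<noteq> {}"
proof -
  show "bounded (box_set a b :: (real^'N) set)" by (simp add: box_set_interval)
  have "(0 :: real^'N) \<in> box_set a b" using a_nonpos b_nonneg by (simp add: box_set_def)
  then show "(box_set a b :: (real^'N) set) \<noteq> {}" by blast
qed

lemma support_nonsmooth: "support_fun (box_set a b) (M *v m) = ereal (nonsmooth m)"
  unfolding nonsmooth_def by (rule support_fun_real[OF box_bounded box_nonempty])

lemma nonsmooth_convex: "convex_on UNIV nonsmooth"
  unfolding nonsmooth_def by (rule convex_on_support_fun[OF box_bounded box_nonempty])

lemma convex_box: "convex (box_set c d)"
  by (simp add: box_set_interval)

lemma feasible_convex: "convex feasible"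
  unfolding feasible_def by (intro convex_Times convex_box convex_UNIV)

lemma dual_objective_eq:
  "dual_objective \<alpha> \<beta> a b K M yd yr z = (if z \<in> feasible then ereal (objective z) else \<infinity>)"
  by (cases z) (simp add: dual_objective_def feasible_def objective_def smooth_def indicator_fun_def
      support_nonsmooth)

lemma p_step_stationary:
  assumes "minimizes q (\<lambda>q. ereal (1/2 * sqnorm Mi (K *v q - M *v yd)
          + 1/(2*\<alpha>) * sqnorm M (q - lam - mu + \<alpha> *\<^sub>R yr) - e \<bullet> q))"
  shows "(K *v d) \<bullet> (Mi *v (K *v q - M *v yd)) + 1/\<alpha> * (d \<bullet> (M *v (q - lam - mu + \<alpha> *\<^sub>R yr))) = e \<bullet> d"
proof -
  define Q where "Q x = 1/2 * sqnorm Mi (K *v x - M *v yd)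
          + 1/(2*\<alpha>) * sqnorm M (x - lam - mu + \<alpha> *\<^sub>R yr) - e \<bullet> x" for x
  define l where "l d = (K *v d) \<bullet> (Mi *v (K *v q - M *v yd))
          + 1/\<alpha> * (d \<bullet> (M *v (q - lam - mu + \<alpha> *\<^sub>R yr))) - e \<bullet> d" for d
  have min: "Q q \<le> Q x" for x
    using assms unfolding is_arg_min_linorder Q_def by simp
  have expand: "Q (q + s *\<^sub>R (z - q)) = Q q + s * l (z - q)
      + s\<^sup>2 * (1/2 * sqnorm Mi (K *v (z - q)) + 1/(2*\<alpha>) * sqnorm M (z - q))" for s z
  proof -
    have 1: "K *v (q + s *\<^sub>R (z - q)) - M *v yd = (K *v q - M *v yd) + s *\<^sub>R (K *v (z - q))"
      by (simp add: matrix_vector_right_distrib matrix_vector_mult_scaleR)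
    have 2: "q + s *\<^sub>R (z - q) - lam - mu + \<alpha> *\<^sub>R yr = (q - lam - mu + \<alpha> *\<^sub>R yr) + s *\<^sub>R (z - q)" by simp
    have 3: "e \<bullet> (q + s *\<^sub>R (z - q)) = e \<bullet> q + s * (e \<bullet> (z - q))" by (simp add: inner_add_right)
    show ?thesis unfolding Q_def l_def 1 2 3 sqnorm_line[OF Mi_sym] sqnorm_line[OF M_sym]
      by (simp add: distrib_left right_diff_distrib add_divide_distrib)
  qed
  have "0 \<le> l d" for d
  proof -
    have "0 \<le> 0 + l ((q + d) - q)"
      by (rule minimizer_variational_inequality[where C = UNIV and g = "\<lambda>_. 0" and q = Q, OF _ _ _ _ expand])
        (use min in \<open>auto simp: convex_on_def\<close>)
    then show ?thesis by simp
  qed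
  moreover have "l (- d) = - l d"
    using matrix_vector_mult_scaleR[of K "-1" d] by (simp add: l_def)
  ultimately have "l d = 0" by (metis neg_0_le_iff_le order_antisym)
  then show ?thesis by (simp add: l_def)
qed

lemma mu_step_optimality:
  assumes "minimizes mut (\<lambda>m. ereal (1/(2*\<alpha>) * sqnorm M (m - c))
          + support_fun (box_set a b) (M *v m)
          + ereal (1/2 * sqnorm (D1 \<alpha> cn M W) (m - mu)) - ereal (e \<bullet> m))"
  shows "nonsmooth mut \<le> nonsmooth z + (1/\<alpha> * ((z - mut) \<bullet> (M *v (mut - c)))
      + (z - mut) \<bullet> (D1 \<alpha> cn M W *v (mut - mu)) - e \<bullet> (z - mut))"
proof -
  define Q where "Q x = 1/(2*\<alpha>) * sqnorm M (x - c) + 1/2 * sqnorm (D1 \<alpha> cn M W) (x - mu) - e \<bullet> x" for x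
  have "ereal (Q mut + nonsmooth mut) \<le> ereal (Q x + nonsmooth x)" for x
    using assms unfolding is_arg_min_linorder support_nonsmooth Q_def by (simp add: add.commute add.left_commute add_diff_eq)
  then have min: "Q mut + nonsmooth mut \<le> Q x + nonsmooth x" for x by simp
  have expand: "Q (mut + s *\<^sub>R (z - mut)) = Q mut + s * (1/\<alpha> * ((z - mut) \<bullet> (M *v (mut - c)))
      + (z - mut) \<bullet> (D1 \<alpha> cn M W *v (mut - mu)) - e \<bullet> (z - mut))
      + s\<^sup>2 * (1/(2*\<alpha>) * sqnorm M (z - mut) + 1/2 * sqnorm (D1 \<alpha> cn M W) (z - mut))" for s
  proof -
    have 1: "mut + s *\<^sub>R (z - mut) - x = (mut - x) + s *\<^sub>R (z - mut)" for x by simp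
    have 3: "e \<bullet> (mut + s *\<^sub>R (z - mut)) = e \<bullet> mut + s * (e \<bullet> (z - mut))" by (simp add: inner_add_right)
    show ?thesis unfolding Q_def 1 3 sqnorm_line[OF D1_sym] sqnorm_line[OF M_sym]
      by (simp add: distrib_left right_diff_distrib add_divide_distrib)
  qed
  show ?thesis
    by (rule minimizer_variational_inequality[OF nonsmooth_convex UNIV_I UNIV_I min expand])
qed

lemma lam_step_optimality:
  assumes "minimizes lamt (\<lambda>l. ereal (1/(2*\<alpha>) * sqnorm M (l - c))
          + indicator_fun (box_set (-\<beta>) \<beta>) l
          + ereal (1/(2*\<alpha>) * sqnorm (W - M) (l - lam)))"
  shows "lamt \<in> box_set (-\<beta>) \<beta>"
    and "z \<in> box_set (-\<beta>) \<beta> \<Longrightarrow> 0 \<le> 1/\<alpha> * ((z - lamt) \<bullet> (M *v (lamt - c)))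
      + 1/\<alpha> * ((z - lamt) \<bullet> ((W - M) *v (lamt - lam)))"
proof -
  define Q where "Q x = 1/(2*\<alpha>) * sqnorm M (x - c) + 1/(2*\<alpha>) * sqnorm (W - M) (x - lam)" for x
  have le: "ereal (Q lamt) + indicator_fun (box_set (-\<beta>) \<beta>) lamt
      \<le> ereal (Q x) + indicator_fun (box_set (-\<beta>) \<beta>) x" for x
    using assms unfolding is_arg_min_linorder Q_def indicator_fun_def by (auto split: if_splits)
  have "0 \<in> box_set (-\<beta>) \<beta>" using \<beta>_nonneg by (simp add: box_set_def)
  with le[of 0] show box: "lamt \<in> box_set (-\<beta>) \<beta>"
    by (auto simp: indicator_fun_def split: if_splits)
  assume z: "z \<in> box_set (-\<beta>) \<beta>"
  have min: "Q lamt + 0 \<le> Q x + 0" if "x \<in> box_set (-\<beta>) \<beta>" for x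
    using le[of x] box that by (simp add: indicator_fun_def)
  have expand: "Q (lamt + s *\<^sub>R (z - lamt)) = Q lamt + s * (1/\<alpha> * ((z - lamt) \<bullet> (M *v (lamt - c)))
      + 1/\<alpha> * ((z - lamt) \<bullet> ((W - M) *v (lamt - lam))))
      + s\<^sup>2 * (1/(2*\<alpha>) * sqnorm M (z - lamt) + 1/(2*\<alpha>) * sqnorm (W - M) (z - lamt))" for s
  proof -
    have 1: "lamt + s *\<^sub>R (z - lamt) - x = (lamt - x) + s *\<^sub>R (z - lamt)" for x by simp
    show ?thesis unfolding Q_def 1 sqnorm_line[OF W_minus_M_sym] sqnorm_line[OF M_sym]
      by (simp add: distrib_left right_diff_distrib add_divide_distrib)
  qed
  have "convex_on (box_set (-\<beta>) \<beta> :: (real^'N) set) (\<lambda>_. 0 :: real)"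
    by (simp add: convex_on_def convex_box)
  from minimizer_variational_inequality[OF this box z min expand]
  show "0 \<le> 1/\<alpha> * ((z - lamt) \<bullet> (M *v (lamt - c)))
      + 1/\<alpha> * ((z - lamt) \<bullet> ((W - M) *v (lamt - lam)))" by simp
qed

lemma inner_R: "x \<bullet> (R *v y) = (K *v x) \<bullet> (Mi *v (K *v y))"
  by (simp add: R_def inner_matrix_vector_left matrix_vector_mul_assoc[symmetric])

text \<open>The two updates of \<open>p\<close> in a sweep solve the same linear system with matrix \<open>H\<close>; their right-hand
  sides differ only through \<open>\<lambda>\<close> and the error vectors. This is what turns the auxiliary \<open>p\<close> into the
  proximal term of \<open>\<D>\<^sub>2\<close>.\<close>

lemma p_difference:
  assumes 1: "\<And>d. (K *v d) \<bullet> (Mi *v (K *v ph - M *v yd))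
       + 1/\<alpha> * (d \<bullet> (M *v (ph - lam - mut + \<alpha> *\<^sub>R yr))) = e \<bullet> d"
    and 2: "\<And>d. (K *v d) \<bullet> (Mi *v (K *v pt - M *v yd))
       + 1/\<alpha> * (d \<bullet> (M *v (pt - lamt - mut + \<alpha> *\<^sub>R yr))) = e' \<bullet> d"
  shows "ph - pt = G *v ((1/\<alpha>) *\<^sub>R (M *v (lam - lamt)) + (e - e'))"
proof -
  have "d \<bullet> (H *v (ph - pt)) = d \<bullet> ((1/\<alpha>) *\<^sub>R (M *v (lam - lamt)) + (e - e'))" for d
  proof -
    have "d \<bullet> (R *v (ph - pt)) = (K *v d) \<bullet> (Mi *v (K *v ph - M *v yd)) - (K *v d) \<bullet> (Mi *v (K *v pt - M *v yd))"
      unfolding inner_R by (simp add: matrix_vector_mult_diff_distrib inner_diff_right)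
    moreover have "d \<bullet> (M *v (ph - lam - mut + \<alpha> *\<^sub>R yr)) - d \<bullet> (M *v (pt - lamt - mut + \<alpha> *\<^sub>R yr))
        = d \<bullet> (M *v (ph - pt)) - d \<bullet> (M *v (lam - lamt))"
      by (simp add: matrix_vector_mult_diff_distrib matrix_vector_right_distrib inner_diff_right inner_add_right)
    then have "1/\<alpha> * (d \<bullet> (M *v (ph - lam - mut + \<alpha> *\<^sub>R yr))) - 1/\<alpha> * (d \<bullet> (M *v (pt - lamt - mut + \<alpha> *\<^sub>R yr)))
        = 1/\<alpha> * (d \<bullet> (M *v (ph - pt))) - 1/\<alpha> * (d \<bullet> (M *v (lam - lamt)))"
      by (metis right_diff_distrib)
    moreover have "d \<bullet> (H *v (ph - pt)) = d \<bullet> (R *v (ph - pt)) + 1/\<alpha> * (d \<bullet> (M *v (ph - pt)))"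
      by (simp add: H_def matrix_vector_mult_add_rdistrib scaleR_matrix_vector_assoc[symmetric] inner_add_right)
    ultimately show ?thesis using 1[of d] 2[of d]
      by (simp add: inner_add_right inner_diff_right inner_commute[of e] inner_commute[of e'])
  qed
  then have "H *v (ph - pt) = (1/\<alpha>) *\<^sub>R (M *v (lam - lamt)) + (e - e')"
    using vector_eq_rdot inner_commute by metis
  then show ?thesis
    by (metis matrix_vector_mul_assoc matrix_inv_inverse(2)[OF H_inv] matrix_vector_mul_lid)
qed

text \<open>Here \<open>(m, l, q)\<close> points from the new iterate to a competitor and \<open>(dm, dl, dq)\<close> to the
  extrapolated point. The inner products on the right are the proximal terms and the defect of the
  \<open>\<mu>\<close>-update, which used \<open>\<lambda>\<close> and \<open>p\<close> before their update. The defect is absorbed because the Hessian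
  form is nonnegative at \<open>(m, l - dl, q - dq)\<close>.\<close>

lemma metric_form_gain:
  "(metric_form (m, l, q) - metric_form (dm - m, dl - l, dq - q)) / 2
    \<le> m \<bullet> (D1 \<alpha> cn M W *v dm) + 1/\<alpha> * (l \<bullet> ((W - M) *v dl))
      + (1/\<alpha>)\<^sup>2 * ((M *v l) \<bullet> (G *v (M *v dl)))
      - 1/\<alpha> * (m \<bullet> (M *v (dl - dq))) + hessian_form (m, l, q) / 2"
proof -
  have a: "0 < 1/\<alpha>" using \<alpha>_pos by simp
  have 1: "(sqnorm (D1 \<alpha> cn M W) m - sqnorm (D1 \<alpha> cn M W) (dm - m)) / 2 \<le> m \<bullet> (D1 \<alpha> cn M W *v dm)"
    by (rule sqnorm_three_point[OF D1_sym D1_nonneg])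
  have 2: "1/\<alpha> * ((sqnorm (W - M) l - sqnorm (W - M) (dl - l)) / 2) \<le> 1/\<alpha> * (l \<bullet> ((W - M) *v dl))"
    by (rule mult_left_mono[OF sqnorm_three_point[OF W_minus_M_sym W_minus_M_nonneg]]) (use a in simp)
  have 3: "(1/\<alpha>)\<^sup>2 * ((sqnorm G (M *v l) - sqnorm G (M *v (dl - l))) / 2) \<le> (1/\<alpha>)\<^sup>2 * ((M *v l) \<bullet> (G *v (M *v dl)))"
    unfolding matrix_vector_mult_diff_distrib
    by (rule mult_left_mono[OF sqnorm_three_point[OF G_sym G_nonneg]]) simp
  have "0 \<le> sqnorm M (m + ((l - q) - (dl - dq)))" by (rule M_nonneg)
  also have "\<dots> = sqnorm M m + 2 * (m \<bullet> (M *v (l - q))) - 2 * (m \<bullet> (M *v (dl - dq)))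
      + sqnorm M ((l - q) - (dl - dq))"
    unfolding sqnorm_add[OF M_sym] by (simp add: matrix_vector_mult_diff_distrib inner_diff_right right_diff_distrib)
  also have "sqnorm M ((l - q) - (dl - dq)) = sqnorm M ((dl - l) - (dq - q))"
  proof -
    have "(l - q) - (dl - dq) = (-1) *\<^sub>R ((dl - l) - (dq - q))" by simp
    then show ?thesis by (metis sqnorm_scaleR power2_minus one_power2 mult_1)
  qed
  also have "sqnorm M m = sqnorm M (l + m - q) - sqnorm M (l - q) - 2 * (m \<bullet> (M *v (l - q)))"
    using sqnorm_add[OF M_sym, of m "l - q"] by (simp add: algebra_simps)
  finally have "0 \<le> sqnorm M (l + m - q) - sqnorm M (l - q) - 2 * (m \<bullet> (M *v (dl - dq)))
      + sqnorm M ((dl - l) - (dq - q))" by simp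
  then have 4: "0 \<le> 1/\<alpha> * (sqnorm M (l + m - q) - sqnorm M (l - q) - 2 * (m \<bullet> (M *v (dl - dq)))
      + sqnorm M ((dl - l) - (dq - q)))"
    by (rule mult_nonneg_nonneg[OF less_imp_le[OF a]])
  show ?thesis
    using 1 2 3 4 R_nonneg[of "dq - q"] unfolding metric_form_def hessian_form_def prod.case by argo
qed

text \<open>One sweep is an inexact proximal step in the seminorm of \<open>metric_form\<close>. The inequality is the sum of
  the first-order conditions of the updates and the exact expansion of the smooth part. The error
  vectors of the \<open>\<mu>\<close>-update and of the last \<open>p\<close>-update enter directly; the difference of those of the
  two \<open>p\<close>-updates reaches the \<open>\<lambda>\<close>-component through \<open>M G / \<alpha>\<close>.\<close>

lemma sGS_step_descent:
  "\<exists>C. \<forall>eps mu lam p mut lamt pt. sGS_step \<alpha> \<beta> a b cn K M W yd yr eps mu lam p mut lamt pt \<longrightarrow>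
     (mut, lamt, pt) \<in> feasible \<and>
     (\<exists>e. norm e \<le> C * eps \<and> (\<forall>w\<in>feasible. objective (mut, lamt, pt) + e \<bullet> (w - (mut, lamt, pt))
        + (metric_form ((mut, lamt, pt) - w) - metric_form ((mu, lam, p) - w)) / 2 \<le> objective w))"
proof -
  obtain B where B: "\<And>v. norm ((1/\<alpha>) *\<^sub>R (M *v (G *v v))) \<le> norm v * B"
    using bounded_linear.bounded[OF bounded_linear_compose[OF bounded_linear_scaleR_right
         bounded_linear_compose[OF matrix_vector_mul_bounded_linear[of M] matrix_vector_mul_bounded_linear[of G]]]]
    by blast
  show ?thesis
  proof (intro exI[of _ "2 + 2 * \<bar>B\<bar>"] allI impI conjI)
    fix eps mu lam p mut lamt pt
    assume "sGS_step \<alpha> \<beta> a b cn K M W yd yr eps mu lam p mut lamt pt"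
    then obtain dmu dph dp ph where
      tol: "Max {norm dmu, norm dph, norm dp} \<le> eps"
      and mu_min: "minimizes mut (\<lambda>m. ereal (1/(2*\<alpha>) * sqnorm M (m - (p - lam)))
          + support_fun (box_set a b) (M *v m)
          + ereal (1/2 * sqnorm (D1 \<alpha> cn M W) (m - mu)) - ereal (dmu \<bullet> m))"
      and ph_min: "minimizes ph (\<lambda>q. ereal (1/2 * sqnorm (matrix_inv M) (K *v q - M *v yd)
          + 1/(2*\<alpha>) * sqnorm M (q - lam - mut + \<alpha> *\<^sub>R yr) - dph \<bullet> q))"
      and lam_min: "minimizes lamt (\<lambda>l. ereal (1/(2*\<alpha>) * sqnorm M (l - (ph - mut)))
          + indicator_fun (box_set (-\<beta>) \<beta>) l
          + ereal (1/(2*\<alpha>) * sqnorm (W - M) (l - lam)))"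
      and pt_min: "minimizes pt (\<lambda>q. ereal (1/2 * sqnorm (matrix_inv M) (K *v q - M *v yd)
          + 1/(2*\<alpha>) * sqnorm M (q - lamt - mut + \<alpha> *\<^sub>R yr) - dp \<bullet> q))"
      unfolding sGS_step_def by blast
    have tol: "norm dmu \<le> eps" "norm dph \<le> eps" "norm dp \<le> eps" using tol by auto
    note V1 = mu_step_optimality[OF mu_min]
    note V2 = p_step_stationary[OF ph_min]
    note V3 = lam_step_optimality(2)[OF lam_min]
    note V4 = p_step_stationary[OF pt_min]
    note box = lam_step_optimality(1)[OF lam_min]
    show feas: "(mut, lamt, pt) \<in> feasible" using box by (simp add: feasible_def)
    define el where "el = (1/\<alpha>) *\<^sub>R (M *v (G *v (dph - dp)))"
    have ph: "ph - pt = G *v ((1/\<alpha>) *\<^sub>R (M *v (lam - lamt)) + (dph - dp))"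
      by (rule p_difference[OF V2 V4])
    show "\<exists>e. norm e \<le> (2 + 2 * \<bar>B\<bar>) * eps \<and> (\<forall>w\<in>feasible. objective (mut, lamt, pt) + e \<bullet> (w - (mut, lamt, pt))
        + (metric_form ((mut, lamt, pt) - w) - metric_form ((mu, lam, p) - w)) / 2 \<le> objective w)"
    proof (intro exI[of _ "(dmu, el, dp)"] conjI ballI)
      have "norm el \<le> norm (dph - dp) * \<bar>B\<bar>" unfolding el_def
        using B[of "dph - dp"] by (smt (verit) abs_ge_self mult_left_mono norm_ge_zero)
      also have "\<dots> \<le> (2 * eps) * \<bar>B\<bar>"
        by (rule mult_right_mono) (use norm_triangle_ineq4[of dph dp] tol in auto)
      finally show "norm (dmu, el, dp) \<le> (2 + 2 * \<bar>B\<bar>) * eps"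
        using norm_Pair_le[of dmu "(el, dp)"] norm_Pair_le[of el dp] tol by (simp add: algebra_simps)
    next
      fix w assume w: "w \<in> feasible"
      obtain wm wl wp where w_eq: "w = (wm, wl, wp)" by (metis surj_pair)
      define m l q where "m = wm - mut" and "l = wl - lamt" and "q = wp - pt"
      define dm dl dq where "dm = mu - mut" and "dl = lam - lamt" and "dq = p - pt"
      define r where "r = lamt + mut - pt"
      have smooth: "smooth w = smooth (mut, lamt, pt)
        + (1/\<alpha> * ((l + m - q) \<bullet> (M *v r)) + (K *v q) \<bullet> (Mi *v (K *v pt - M *v yd)) + (M *v yr) \<bullet> q)
        + hessian_form (m, l, q) / 2"
        using smooth_add[of mut lamt pt m l q] by (simp add: w_eq m_def l_def q_def r_def)
      \<comment> \<open>The last \<open>p\<close>-update is an exact block minimization up to its error vector, so the \<open>p\<close>-part of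
        the gradient at the new iterate is that error vector.\<close>
      have A4: "(K *v q) \<bullet> (Mi *v (K *v pt - M *v yd)) = dp \<bullet> q + 1/\<alpha> * (q \<bullet> (M *v r)) - (M *v yr) \<bullet> q"
      proof -
        have eq: "pt - lamt - mut + \<alpha> *\<^sub>R yr = \<alpha> *\<^sub>R yr - r" by (simp add: r_def)
        have "1/\<alpha> * (q \<bullet> (M *v (pt - lamt - mut + \<alpha> *\<^sub>R yr))) = (M *v yr) \<bullet> q - 1/\<alpha> * (q \<bullet> (M *v r))"
          unfolding eq matrix_vector_mult_diff_distrib matrix_vector_mult_scaleR inner_diff_right
          using \<alpha>_pos by (simp add: inner_commute[of q] diff_divide_distrib)
        then show ?thesis using V4[of q] by linarith
      qed
      \<comment> \<open>The residual seen by the \<open>\<mu>\<close>-update is \<open>r + (dl - dq)\<close>, since it uses the extrapolated \<open>\<lambda>\<close> and \<open>p\<close>.\<close>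
      have A1: "nonsmooth mut \<le> nonsmooth wm + (1/\<alpha> * (m \<bullet> (M *v r)) + 1/\<alpha> * (m \<bullet> (M *v (dl - dq)))
          - m \<bullet> (D1 \<alpha> cn M W *v dm) - dmu \<bullet> m)"
      proof -
        have "mut - (p - lam) = r + (dl - dq)" "mut - mu = - dm"
          by (simp_all add: r_def dl_def dq_def dm_def)
        then show ?thesis using V1[of wm] matrix_vector_mult_scaleR[of "D1 \<alpha> cn M W" "-1" dm]
          by (simp add: m_def[symmetric] matrix_vector_right_distrib inner_add_right distrib_left add_divide_distrib)
      qed
      \<comment> \<open>The \<open>\<lambda>\<close>-update sees the residual with the auxiliary \<open>p\<close>; the difference of the two values of
        \<open>p\<close> supplies the remaining part of the proximal term of \<open>\<D>\<^sub>2\<close>.\<close>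
      have A3: "1/\<alpha> * (l \<bullet> ((W - M) *v dl)) + (1/\<alpha>)\<^sup>2 * ((M *v l) \<bullet> (G *v (M *v dl))) + el \<bullet> l
          \<le> 1/\<alpha> * (l \<bullet> (M *v r))"
      proof -
        have eqs: "lamt - (ph - mut) = r - (ph - pt)" "lamt - lam = - dl" by (simp_all add: r_def dl_def)
        have "1/\<alpha> * (l \<bullet> (M *v (ph - pt))) = (1/\<alpha>)\<^sup>2 * ((M *v l) \<bullet> (G *v (M *v dl))) + el \<bullet> l"
          unfolding ph dl_def[symmetric] el_def
          by (simp add: matrix_vector_right_distrib matrix_vector_mult_scaleR inner_add_right distrib_left
              inner_matrix_vector_left[of M l] M_sym power2_eq_square inner_commute[of l] add_divide_distrib)
        moreover have "0 \<le> 1/\<alpha> * (l \<bullet> (M *v r)) - 1/\<alpha> * (l \<bullet> (M *v (ph - pt))) - 1/\<alpha> * (l \<bullet> ((W - M) *v dl))"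
        proof -
          have "0 \<le> 1/\<alpha> * (l \<bullet> (M *v (r - (ph - pt)))) + 1/\<alpha> * (l \<bullet> ((W - M) *v (- dl)))"
            using V3[of wl] w unfolding eqs l_def by (auto simp: w_eq feasible_def)
          moreover have "(W - M) *v (- dl) = - ((W - M) *v dl)"
            using matrix_vector_mult_scaleR[of "W - M" "-1" dl] by simp
          moreover have "1/\<alpha> * (l \<bullet> (M *v (r - (ph - pt)))) = 1/\<alpha> * (l \<bullet> (M *v r)) - 1/\<alpha> * (l \<bullet> (M *v (ph - pt)))"
            by (metis matrix_vector_mult_diff_distrib inner_diff_right right_diff_distrib)
          ultimately show ?thesis by simp
        qed
        ultimately show ?thesis by linarith
      qed
      have lin: "1/\<alpha> * ((l + m - q) \<bullet> (M *v r)) = 1/\<alpha> * (l \<bullet> (M *v r)) + 1/\<alpha> * (m \<bullet> (M *v r)) - 1/\<alpha> * (q \<bullet> (M *v r))"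
        by (simp add: inner_add_left inner_diff_left distrib_left right_diff_distrib add_divide_distrib diff_divide_distrib)
      have e: "(dmu, el, dp) \<bullet> (w - (mut, lamt, pt)) = dmu \<bullet> m + el \<bullet> l + dp \<bullet> q"
        by (simp add: w_eq m_def l_def q_def inner_prod_def)
      have "(mut, lamt, pt) - w = (-1) *\<^sub>R (m, l, q)"
        by (simp add: w_eq m_def l_def q_def)
      then have met1: "metric_form ((mut, lamt, pt) - w) = metric_form (m, l, q)"
        by (metis metric_form_scaleR power2_minus one_power2 mult_1)
      have met2: "(mu, lam, p) - w = (dm - m, dl - l, dq - q)"
        by (simp add: w_eq m_def l_def q_def dm_def dl_def dq_def)
      have obj: "objective w = smooth w + nonsmooth wm - 1/2 * sqnorm M yd"
        "objective (mut, lamt, pt) = smooth (mut, lamt, pt) + nonsmooth mut - 1/2 * sqnorm M yd"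
        by (simp_all add: objective_def w_eq)
      show "objective (mut, lamt, pt) + (dmu, el, dp) \<bullet> (w - (mut, lamt, pt))
        + (metric_form ((mut, lamt, pt) - w) - metric_form ((mu, lam, p) - w)) / 2 \<le> objective w"
        unfolding e met1 met2 obj smooth A4 lin
        using A1 A3 metric_form_gain[of m l q dm dl dq] by linarith
    qed
  qed
qed

lemma smooth_line:
  "\<exists>l. (\<forall>s. smooth (z + s *\<^sub>R d) = smooth z + s * l + s\<^sup>2 * (hessian_form d / 2))"
proof -
  obtain mu lam p where z: "z = (mu, lam, p)" by (metis surj_pair)
  obtain m l q where d: "d = (m, l, q)" by (metis surj_pair)
  have "smooth (z + s *\<^sub>R d) = smooth z
     + s * (1/\<alpha> * ((l + m - q) \<bullet> (M *v (lam + mu - p)))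
        + (K *v q) \<bullet> (Mi *v (K *v p - M *v yd)) + (M *v yr) \<bullet> q)
     + s\<^sup>2 * (hessian_form d / 2)" for s
  proof -
    have "s *\<^sub>R l + s *\<^sub>R m - s *\<^sub>R q = s *\<^sub>R (l + m - q)" by (simp add: algebra_simps)
    then show ?thesis
      using smooth_add[of mu lam p "s *\<^sub>R m" "s *\<^sub>R l" "s *\<^sub>R q"] hessian_form_scaleR[of s d]
      by (simp add: z d matrix_vector_mult_scaleR distrib_left del: add_Pair)
  qed
  then show ?thesis by blast
qed

lemma nonsmooth_fst_convex: "convex_on feasible (\<lambda>z. nonsmooth (fst z))"
  unfolding convex_on_def using feasible_convex nonsmooth_convex by (auto simp: convex_on_def)

lemma smooth_convex: "convex_on feasible smooth"
proof (rule convex_onI)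
  fix t :: real and x y assume t: "0 < t" "t < 1"
  obtain l where l: "\<And>s. smooth (x + s *\<^sub>R (y - x)) = smooth x + s * l + s\<^sup>2 * (hessian_form (y - x) / 2)"
    using smooth_line by blast
  have "(1 - t) *\<^sub>R x + t *\<^sub>R y = x + t *\<^sub>R (y - x)" by (simp add: algebra_simps)
  then have eq: "smooth ((1 - t) *\<^sub>R x + t *\<^sub>R y) = smooth x + t * l + t\<^sup>2 * (hessian_form (y - x) / 2)"
    by (simp only: l)
  have y: "smooth y = smooth x + l + hessian_form (y - x) / 2" using l[of 1] by simp
  have "t\<^sup>2 * (hessian_form (y - x) / 2) \<le> t * (hessian_form (y - x) / 2)"
    by (rule mult_right_mono) (use t hessian_form_nonneg in \<open>auto simp: power2_eq_square mult_le_cancel_left1\<close>)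
  then show "smooth ((1 - t) *\<^sub>R x + t *\<^sub>R y) \<le> (1 - t) * smooth x + t * smooth y"
    unfolding eq y by (simp add: algebra_simps)
qed (rule feasible_convex)

lemma objective_eq: "objective z = smooth z + nonsmooth (fst z) - 1/2 * sqnorm M yd"
  by (cases z) (simp add: objective_def)

lemma objective_convex: "convex_on feasible objective"
proof -
  have "convex_on feasible (\<lambda>z. (smooth z + nonsmooth (fst z)) + (- (1/2 * sqnorm M yd)))"
    by (intro convex_on_add smooth_convex nonsmooth_fst_convex convex_onI feasible_convex)
      (simp add: field_simps)
  then show ?thesis by (simp add: objective_eq[abs_def])
qed

lemma minimizer_feasible:
  assumes "minimizes z (dual_objective \<alpha> \<beta> a b K M yd yr)"
  shows "z \<in> feasible" and "\<And>w. w \<in> feasible \<Longrightarrow> objective z \<le> objective w"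
proof -
  have min: "dual_objective \<alpha> \<beta> a b K M yd yr z \<le> dual_objective \<alpha> \<beta> a b K M yd yr w" for w
    using assms unfolding is_arg_min_linorder by blast
  have "(0, 0, 0) \<in> feasible" using \<beta>_nonneg by (simp add: feasible_def box_set_def)
  then show feas: "z \<in> feasible" using min[of "(0, 0, 0)"] by (auto simp: dual_objective_eq split: if_splits)
  show "objective z \<le> objective w" if "w \<in> feasible" for w
    using min[of w] feas that by (simp add: dual_objective_eq)
qed

text \<open>The smooth part equals its linearization plus half the Hessian form, and at a minimizer the
  linearization plus the convex part does not decrease.\<close>

lemma quadratic_growth:
  assumes min: "minimizes z (dual_objective \<alpha> \<beta> a b K M yd yr)" and w: "w \<in> feasible"
  shows "objective z + hessian_form (w - z) / 2 \<le> objective w"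
proof -
  obtain l where l: "\<And>s. smooth (z + s *\<^sub>R (w - z)) = smooth z + s * l + s\<^sup>2 * (hessian_form (w - z) / 2)"
    using smooth_line by blast
  have "nonsmooth (fst z) \<le> nonsmooth (fst w) + l"
    by (rule minimizer_variational_inequality[OF nonsmooth_fst_convex minimizer_feasible(1)[OF min] w _ l])
      (use minimizer_feasible(2)[OF min] in \<open>simp add: objective_eq\<close>)
  moreover have "smooth w = smooth z + l + hessian_form (w - z) / 2" using l[of 1] by simp
  ultimately show ?thesis by (simp add: objective_eq)
qed

theorem sGS_imABCD_rate:
  assumes alg: "sGS_imABCD \<alpha> \<beta> a b cn K M W yd yr eps mut lamt pt"
    and eps_sum: "summable (\<lambda>k. real k * eps k)"
    and min: "minimizes z (dual_objective \<alpha> \<beta> a b K M yd yr)"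
  shows "\<exists>c. \<forall>k\<ge>1. (mut k, lamt k, pt k) \<in> feasible \<and>
     objective (mut k, lamt k, pt k) - objective z \<le> c / (real k + 1)\<^sup>2"
proof -
  obtain mu lam p and t :: "nat \<Rightarrow> real" where init: "lamt 0 \<in> box_set (-\<beta>) \<beta>"
      "mu 1 = mut 0" "lam 1 = lamt 0" "p 1 = pt 0" "t 1 = 1"
    and step: "\<And>k. k \<ge> 1 \<Longrightarrow> sGS_step \<alpha> \<beta> a b cn K M W yd yr (eps k) (mu k) (lam k) (p k) (mut k) (lamt k) (pt k)"
    and t: "\<And>k. k \<ge> 1 \<Longrightarrow> t (Suc k) = (1 + sqrt (1 + 4 * (t k)\<^sup>2)) / 2"
    and ext: "\<And>k. k \<ge> 1 \<Longrightarrow> mu (Suc k) = mut k + ((t k - 1) / t (Suc k)) *\<^sub>R (mut k - mut (k - 1))"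
       "\<And>k. k \<ge> 1 \<Longrightarrow> p (Suc k) = pt k + ((t k - 1) / t (Suc k)) *\<^sub>R (pt k - pt (k - 1))"
       "\<And>k. k \<ge> 1 \<Longrightarrow> lam (Suc k) = lamt k + ((t k - 1) / t (Suc k)) *\<^sub>R (lamt k - lamt (k - 1))"
    using alg unfolding sGS_imABCD_def by blast
  define x where "x k = (mut k, lamt k, pt k)" for k
  define y where "y k = (mu k, lam k, p k)" for k
  \<comment> \<open>The algorithm starts its parameters at index \<open>1\<close>; the value \<open>0\<close> at index \<open>0\<close> fits the recursion.\<close>
  define \<tau> where "\<tau> k = (if k = 0 then 0 else t k)" for k
  have \<tau>: "\<tau> 0 = 0" "\<tau> (Suc k) = (1 + sqrt (1 + 4 * (\<tau> k)\<^sup>2)) / 2" for k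
    using t[of k] init(5) by (auto simp: \<tau>_def)
  have y: "y (Suc k) = x k + ((\<tau> k - 1) / \<tau> (Suc k)) *\<^sub>R (x k - x (k - 1))" for k
    using ext[of k] init(2-4) by (cases "k = 0") (auto simp: \<tau>_def x_def y_def)
  obtain C where C: "\<And>k. k \<ge> 1 \<Longrightarrow> x k \<in> feasible \<and>
     (\<exists>e. norm e \<le> C * eps k \<and> (\<forall>w\<in>feasible. objective (x k) + e \<bullet> (w - x k)
        + (metric_form (x k - w) - metric_form (y k - w)) / 2 \<le> objective w))"
    using sGS_step_descent step unfolding x_def y_def by meson
  have "\<forall>k. \<exists>e. norm e \<le> C * eps (Suc k) \<and> (\<forall>w\<in>feasible. objective (x (Suc k)) + e \<bullet> (w - x (Suc k))
        + (metric_form (x (Suc k) - w) - metric_form (y (Suc k) - w)) / 2 \<le> objective w)"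
    using C by simp
  then obtain \<delta> where \<delta>: "\<And>k. norm (\<delta> k) \<le> C * eps (Suc k)"
    "\<And>k w. w \<in> feasible \<Longrightarrow> objective (x (Suc k)) + \<delta> k \<bullet> (w - x (Suc k))
        + (metric_form (x (Suc k) - w) - metric_form (y (Suc k) - w)) / 2 \<le> objective w"
    by metis
  have xC: "x k \<in> feasible" for k
  proof (cases "k = 0")
    case True then show ?thesis using init(1) by (simp add: x_def feasible_def)
  qed (use C in simp)
  have "summable (\<lambda>k. real (Suc k) * eps (Suc k))"
    using summable_Suc_iff[of "\<lambda>k. real k * eps k"] eps_sum by simp
  from summable_mult[OF this, of C]
  have e_sum: "summable (\<lambda>k. real (Suc k) * (C * eps (Suc k)))" by (simp add: mult.left_commute)
  obtain L where L: "\<And>w. (norm w)\<^sup>2 \<le> L * (metric_form w + hessian_form w)"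
    using forms_coercive by blast
  have "\<exists>c. \<forall>k\<ge>1. objective (x k) - objective z \<le> c / (real k + 1)\<^sup>2"
    by (rule inexact_accelerated_gradient_rate[where S = metric_form and Q = hessian_form,
       OF \<tau> y objective_convex xC minimizer_feasible(1)[OF min] \<delta>(2) \<delta>(1) e_sum quadratic_growth[OF min]
       metric_form_nonneg metric_form_scaleR hessian_form_nonneg hessian_form_scaleR hessian_form_diff_le L])
  then show ?thesis using xC unfolding x_def by blast
qed

end

section \<open>Convergence rate\<close>

theorem theorem9:
  fixes \<Omega> :: "(real^'n::finite) set"
    and \<alpha> \<beta> a b \<theta> :: real
    and A :: "real^'n \<Rightarrow> real^'n^'n" and c :: "real^'n \<Rightarrow> real"
    and H :: "real set" and \<T> :: "real \<Rightarrow> (real^'n) set set" and h :: real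
    and \<phi> :: "'N::finite \<Rightarrow> real^'n \<Rightarrow> real"
    and K M W :: "real^'N^'N" and yd yr :: "real^'N"
    and eps :: "nat \<Rightarrow> real"
    and mut lamt pt :: "nat \<Rightarrow> real^'N"
    and mus lams ps :: "real^'N"
  assumes dim: "CARD('n) = 2 \<or> CARD('n) = 3"
    and domain: "\<Omega> \<noteq> {}" "open \<Omega>" "convex \<Omega>" "bounded \<Omega>"
    and boundary: "C11_boundary \<Omega> \<or> polytope (closure \<Omega>)"
    and params: "0 < \<alpha>" "0 < \<beta>" "a \<le> 0" "0 \<le> b"
    and coeffs: "elliptic_coefficients \<Omega> A c \<theta>"
    and mesh: "mesh_family \<Omega> H \<T>" "h \<in> H"
    and basis: "nodal_basis \<Omega> (\<T> h) \<phi>"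
    and K: "K = stiffness_matrix \<Omega> A c \<phi>"
    and M: "M = mass_matrix (\<T> h) \<phi>"
    and W: "W = lumped_mass_matrix (\<T> h) \<phi>"
    and eps_nonneg: "\<forall>k\<ge>1. 0 \<le> eps k"
    and eps_noninc: "\<forall>j k. 1 \<le> j \<longrightarrow> j \<le> k \<longrightarrow> eps k \<le> eps j"
    and eps_sum: "summable (\<lambda>k. real k * eps k)"
    and alg: "sGS_imABCD \<alpha> \<beta> a b (lump_const CARD('n)) K M W yd yr eps mut lamt pt"
    and opt: "minimizes (mus, lams, ps) (dual_objective \<alpha> \<beta> a b K M yd yr)"
  shows "\<exists>c0 :: real. \<forall>k\<ge>1.
    dual_objective \<alpha> \<beta> a b K M yd yr (mut k, lamt k, pt k)
      - dual_objective \<alpha> \<beta> a b K M yd yr (mus, lams, ps)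
    \<le> ereal ((2 * sqnorm_op (S_op \<alpha> (lump_const CARD('n)) K M W)
                  ((mut 0, lamt 0, pt 0) - (mus, lams, ps)) + c0)
              / (real k + 1)\<^sup>2)"
proof -
  have tri: "triangulation (\<T> h)" "\<And>T. T \<in> \<T> h \<Longrightarrow> int CARD('n) simplex T"
    "mesh_interior (\<T> h) \<subseteq> \<Omega>"
    using mesh unfolding mesh_family_def by blast+
  have cn: "lump_const CARD('n) = real (CARD('n) + 2)" using dim by (auto simp: lump_const_def)
  interpret mesh: nodal_mesh \<Omega> "\<T> h" \<phi> by unfold_locales (use tri basis in auto)
  interpret lumped_mass_dual \<alpha> \<beta> a b "lump_const CARD('n)" K M W yd yr
  proof
    show "0 < sqnorm M x" if "x \<noteq> 0" for x
      unfolding M by (rule mesh.mass_matrix_pos[OF that])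
    show "sqnorm M x \<le> sqnorm W x" for x
      unfolding M W by (rule mesh.mass_matrix_le_lumped)
    show "sqnorm W x \<le> lump_const CARD('n) * sqnorm M x" for x
      unfolding M W cn by (rule mesh.lumped_le_mass_matrix)
  qed (use params in \<open>simp_all add: M W transpose_mass_matrix transpose_lumped_mass_matrix\<close>)
  obtain C where C: "\<And>k. k \<ge> 1 \<Longrightarrow> (mut k, lamt k, pt k) \<in> feasible \<and>
     objective (mut k, lamt k, pt k) - objective (mus, lams, ps) \<le> C / (real k + 1)\<^sup>2"
    using sGS_imABCD_rate[OF alg eps_sum opt] by blast
  \<comment> \<open>The first term of the claimed bound does not depend on \<open>k\<close> and is absorbed in the constant.\<close>
  define S0 where "S0 = 2 * sqnorm_op (S_op \<alpha> (lump_const CARD('n)) K M W)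
                  ((mut 0, lamt 0, pt 0) - (mus, lams, ps))"
  show ?thesis
    unfolding S0_def[symmetric]
    using C minimizer_feasible(1)[OF opt]
    by (intro exI[of _ "C - S0"]) (simp add: dual_objective_eq)
qed

end
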